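(* The instances $(G,w,k_1,k_2,k_3)$ of M-EPVCB in which $k_3\le k_1$ can be solved in FPT($k_1$) time, i.e., in time $g(k_1)\cdot\mathrm{poly}(\text{input size})$ for some computable function $g$.
   Context: Graphs are finite, simple, undirected. For $V_0\subseteq V(G)$, $E(V_0)$ denotes the set of edges with at least one endpoint in $V_0$. M-EPVCB: given a bipartite graph $G=(V,E)$, an edge-weight function $w:E\to\mathbb{N}$ (positive integers), and positive integers $k_1,k_2,k_3$, decide whether there exists $V_0\subseteq V$ with $|V_0|\le k_1$ such that $\sum_{e\in E(V_0)}w(e)\ge k_2$ and $E(V_0)$ contains a matching $M$ with $\sum_{e\in M}w(e)\ge k_3$. *)

theory Defs
  imports
    "HOL-Library.Log_Nat"
    "HOL-Computational_Algebra.Polynomial"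
begin

section \<open>Machine model\<close>

text \<open>
  The model is a first-order call-by-value functional language over binary trees with
  natural-number leaves (pure first-order Lisp).  A program is a finite list of function bodies; functions take one argument, variables are
  de Bruijn indices.  Every evaluation step costs 1, and arithmetic is charged logarithmically, by
  the bit lengths of its operands.  Sharing subtrees costs nothing, as with pointers, and there is
  no unit-cost comparison of trees, so that a run of time t can be simulated by a Turing machine in
  time polynomial in t and the input size, and conversely (cf. N. D. Jones, Computability and
  Complexity: From a Programming Perspective).
\<close>

datatype val = Num nat | Node val val

datatype expr =
    EVar nat
  | EConst nat
  | EAdd expr expr
  | ESub expr expr
  | ENode expr expr
  | EFst expr
  | ESnd expr
  | EIf expr expr expr
  | ELet expr expr
  | ECall nat expr

type_synonym program = "expr list"

text \<open>
  \<open>eval p \<rho> e v t\<close>: in program \<open>p\<close> and environment \<open>\<rho>\<close>, the expression \<open>e\<close> terminates with value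
  \<open>v\<close> after time \<open>t\<close>.  \<open>ESub\<close> is truncated subtraction, which also provides comparison; \<open>EIf\<close> takes
  its second branch exactly on \<open>Num 0\<close>, the value that also represents the empty list.
\<close>

inductive eval :: "program \<Rightarrow> val list \<Rightarrow> expr \<Rightarrow> val \<Rightarrow> nat \<Rightarrow> bool" for p :: program where
  Var: "i < length \<rho> \<Longrightarrow> eval p \<rho> (EVar i) (\<rho> ! i) 1"
| Const: "eval p \<rho> (EConst n) (Num n) 1"
| Add: "eval p \<rho> a (Num m) s \<Longrightarrow> eval p \<rho> b (Num n) t \<Longrightarrow>
    eval p \<rho> (EAdd a b) (Num (m + n)) (s + t + floorlog 2 m + floorlog 2 n + 1)"
| Sub: "eval p \<rho> a (Num m) s \<Longrightarrow> eval p \<rho> b (Num n) t \<Longrightarrow>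
    eval p \<rho> (ESub a b) (Num (m - n)) (s + t + floorlog 2 m + floorlog 2 n + 1)"
| Node: "eval p \<rho> a u s \<Longrightarrow> eval p \<rho> b v t \<Longrightarrow> eval p \<rho> (ENode a b) (Node u v) (s + t + 1)"
| Fst: "eval p \<rho> a (Node u v) t \<Longrightarrow> eval p \<rho> (EFst a) u (t + 1)"
| Snd: "eval p \<rho> a (Node u v) t \<Longrightarrow> eval p \<rho> (ESnd a) v (t + 1)"
| If_nonzero: "eval p \<rho> c u s \<Longrightarrow> u \<noteq> Num 0 \<Longrightarrow> eval p \<rho> a v t \<Longrightarrow>
    eval p \<rho> (EIf c a b) v (s + t + 1)"
| If_zero: "eval p \<rho> c (Num 0) s \<Longrightarrow> eval p \<rho> b v t \<Longrightarrow> eval p \<rho> (EIf c a b) v (s + t + 1)"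
| Let: "eval p \<rho> a u s \<Longrightarrow> eval p (u # \<rho>) b v t \<Longrightarrow> eval p \<rho> (ELet a b) v (s + t + 1)"
| Call: "eval p \<rho> a u s \<Longrightarrow> f < length p \<Longrightarrow> eval p [u] (p ! f) v t \<Longrightarrow>
    eval p \<rho> (ECall f a) v (s + t + 1)"

lemma eval_deterministic:
  "eval p \<rho> e v t \<Longrightarrow> eval p \<rho> e v' t' \<Longrightarrow> v' = v \<and> t' = t"
proof (induction arbitrary: v' t' rule: eval.induct)
  case (Var i \<rho>)
  from Var.prems show ?case by cases simp_all
next
  case (Const \<rho> n)
  from Const.prems show ?case by cases simp_all
next
  case (Add \<rho> a m s b n t)
  from Add.prems show ?case by cases (use Add.IH in blast)
next
  case (Sub \<rho> a m s b n t)
  from Sub.prems show ?case by cases (use Sub.IH in blast)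
next
  case (Node \<rho> a u s b v t)
  from Node.prems show ?case by cases (use Node.IH in blast)
next
  case (Fst \<rho> a u v t)
  from Fst.prems show ?case by cases (use Fst.IH in blast)
next
  case (Snd \<rho> a u v t)
  from Snd.prems show ?case by cases (use Snd.IH in blast)
next
  case (If_nonzero \<rho> c u s a v t b)
  from If_nonzero.prems show ?case by cases (use If_nonzero.IH If_nonzero.hyps in blast)+
next
  case (If_zero \<rho> c s b v t a)
  from If_zero.prems show ?case by cases (use If_zero.IH in blast)+
next
  case (Let \<rho> a u s b v t)
  from Let.prems show ?case by cases (use Let.IH in blast)
next
  case (Call \<rho> a u s f v t)
  from Call.prems show ?case by cases (use Call.IH in blast)
qed

definition run :: "program \<Rightarrow> val \<Rightarrow> val \<Rightarrow> nat \<Rightarrow> bool" where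
  "run p x v t \<longleftrightarrow> p \<noteq> [] \<and> eval p [x] (p ! 0) v t"

fun val_size :: "val \<Rightarrow> nat" where
  "val_size (Num n) = floorlog 2 n + 1"
| "val_size (Node u v) = val_size u + val_size v + 1"

definition computable :: "(nat \<Rightarrow> nat) \<Rightarrow> bool" where
  "computable g \<longleftrightarrow> (\<exists>p. \<forall>n. \<exists>t. run p (Num n) (Num (g n)) t)"

text \<open>
  \<open>fpt_solvable I enc yes \<kappa>\<close>: the decision problem with instances \<open>I\<close> and yes-instances \<open>yes\<close> is
  solved by one program in time \<open>g(\<kappa>) \<cdot> poly(input size)\<close> with \<open>g\<close> computable.  An instance may have
  several encodings, and the program must be correct and meet the time bound on all of them.
\<close>

definition fpt_solvable ::
  "'i set \<Rightarrow> ('i \<Rightarrow> val \<Rightarrow> bool) \<Rightarrow> ('i \<Rightarrow> bool) \<Rightarrow> ('i \<Rightarrow> nat) \<Rightarrow> bool" where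
  "fpt_solvable I enc yes \<kappa> \<longleftrightarrow>
    (\<exists>p g (q :: nat poly). computable g \<and>
      (\<forall>i\<in>I. \<forall>x. enc i x \<longrightarrow>
        (\<exists>t. run p x (Num (if yes i then 1 else 0)) t \<and> t \<le> g (\<kappa> i) * poly q (val_size x))))"

section \<open>Graphs\<close>

definition simple_graph :: "'v set \<Rightarrow> 'v set set \<Rightarrow> bool" where
  "simple_graph V E \<longleftrightarrow> finite V \<and> (\<forall>e\<in>E. e \<subseteq> V \<and> card e = 2)"

definition bipartite :: "'v set \<Rightarrow> 'v set set \<Rightarrow> bool" where
  "bipartite V E \<longleftrightarrow>
    (\<exists>A B. A \<union> B = V \<and> A \<inter> B = {} \<and> (\<forall>e\<in>E. \<exists>a\<in>A. \<exists>b\<in>B. e = {a, b}))"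

definition covered_edges :: "'v set set \<Rightarrow> 'v set \<Rightarrow> 'v set set" where
  "covered_edges E V0 = {e \<in> E. e \<inter> V0 \<noteq> {}}"

definition matching :: "'v set set \<Rightarrow> bool" where
  "matching M \<longleftrightarrow> (\<forall>e\<in>M. \<forall>f\<in>M. e \<noteq> f \<longrightarrow> e \<inter> f = {})"

section \<open>The problem M-EPVCB\<close>

text \<open>Vertices are named by natural numbers, so that instances can be written down as inputs.\<close>

record mepvcb =
  verts :: "nat set"
  edges :: "nat set set"
  weight :: "nat set \<Rightarrow> nat"
  k1 :: nat
  k2 :: nat
  k3 :: nat

definition mepvcb_instance :: "mepvcb \<Rightarrow> bool" where
  "mepvcb_instance I \<longleftrightarrow>
    simple_graph (verts I) (edges I) \<and> bipartite (verts I) (edges I) \<and>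
    (\<forall>e\<in>edges I. weight I e > 0) \<and> k1 I > 0 \<and> k2 I > 0 \<and> k3 I > 0"

definition mepvcb_yes :: "mepvcb \<Rightarrow> bool" where
  "mepvcb_yes I \<longleftrightarrow>
    (\<exists>V0 \<subseteq> verts I. card V0 \<le> k1 I \<and>
      (\<Sum>e\<in>covered_edges (edges I) V0. weight I e) \<ge> k2 I \<and>
      (\<exists>M \<subseteq> covered_edges (edges I) V0. matching M \<and> (\<Sum>e\<in>M. weight I e) \<ge> k3 I))"

fun val_list :: "val list \<Rightarrow> val" where
  "val_list [] = Num 0"
| "val_list (v # vs) = Node v (val_list vs)"

text \<open>
  An input lists the vertices and the weighted edges \<open>(u, v, w {u, v})\<close>, each exactly once and in
  arbitrary order and orientation, followed by the three bounds.  All numbers count with their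
  binary length; the bipartition is not part of the input.
\<close>

definition mepvcb_encodes :: "mepvcb \<Rightarrow> val \<Rightarrow> bool" where
  "mepvcb_encodes I x \<longleftrightarrow>
    (\<exists>vs es.
      distinct vs \<and> set vs = verts I \<and>
      distinct (map (\<lambda>(u, v, c). {u, v}) es) \<and> set (map (\<lambda>(u, v, c). {u, v}) es) = edges I \<and>
      (\<forall>(u, v, c)\<in>set es. c = weight I {u, v}) \<and>
      x = val_list
        [val_list (map Num vs),
         val_list (map (\<lambda>(u, v, c). val_list [Num u, Num v, Num c]) es),
         Num (k1 I), Num (k2 I), Num (k3 I)])"

lemma mepvcb_encoding_exists:
  assumes "mepvcb_instance I"
  shows "\<exists>x. mepvcb_encodes I x"
proof -
  have sg: "simple_graph (verts I) (edges I)"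
    using assms by (simp add: mepvcb_instance_def)
  then have "finite (verts I)" by (simp add: simple_graph_def)
  then obtain vs where vs: "distinct vs" "set vs = verts I"
    using finite_distinct_list by blast
  have "edges I \<subseteq> Pow (verts I)" using sg by (auto simp: simple_graph_def)
  then have "finite (edges I)" using \<open>finite (verts I)\<close> finite_subset by blast
  then obtain ls where ls: "distinct ls" "set ls = edges I"
    using finite_distinct_list by blast
  have Min_Max: "{Min e, Max e} = e" if "e \<in> set ls" for e
  proof -
    have "card e = 2" using sg that ls(2) by (simp add: simple_graph_def)
    then obtain u v where "e = {u, v}" by (meson card_2_iff)
    then show ?thesis by (cases "u \<le> v") (auto simp: min_def max_def)
  qed
  define es where "es = map (\<lambda>e. (Min e, Max e, weight I e)) ls"
  have "map (\<lambda>(u, v, c). {u, v}) es = map (\<lambda>e. {Min e, Max e}) ls"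
    unfolding es_def by simp
  also have "\<dots> = ls"
    using Min_Max by (rule map_idI)
  finally have map_es: "map (\<lambda>(u, v, c). {u, v}) es = ls" .
  have "\<forall>(u, v, c)\<in>set es. c = weight I {u, v}"
    unfolding es_def by (auto simp: Min_Max)
  with vs ls map_es have "mepvcb_encodes I (val_list
      [val_list (map Num vs),
       val_list (map (\<lambda>(u, v, c). val_list [Num u, Num v, Num c]) es),
       Num (k1 I), Num (k2 I), Num (k3 I)])"
    unfolding mepvcb_encodes_def by (intro exI[of _ vs] exI[of _ es]) simp
  then show ?thesis ..
qed

end

theory Submission
  imports Defs "HOL-Library.Disjoint_Sets"
begin

text \<open>
  Since \<open>k\<^sub>3 \<le> k\<^sub>1\<close>, the two requirements decouple: an instance is a yes-instance iff some set of at
  most \<open>k\<^sub>1\<close> vertices covers weight at least \<open>k\<^sub>2\<close> and, independently, \<open>G\<close> has a matching of at most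
  \<open>k\<^sub>1\<close> edges and weight at least \<open>k\<^sub>3\<close>. Indeed, take \<open>S\<close> of maximum coverage. If \<open>E(S)\<close> has no
  matching of size \<open>k\<^sub>3\<close>, then by Koenig's theorem fewer than \<open>k\<^sub>3 \<le> k\<^sub>1\<close> vertices cover \<open>E(S)\<close>;
  they must cover all of \<open>E\<close>, since adding an endpoint of an uncovered edge would beat \<open>S\<close>.

  Each requirement asks for a heavy packing of at most \<open>k\<^sub>1\<close> items (vertices or edges). If there is
  one, then there is one containing one of the \<open>N = 2\<^bsup>2k+2\<^esup>\<close> heaviest items, where \<open>k = k\<^sub>1\<close>, so it
  suffices to branch over these and to recurse. For vertices, \<open>k\<close> of the \<open>2k\<close> heaviest ones lie on
  one side of the bipartition and are as good as any \<open>k\<close> others. For edges, more than \<open>4k\<^sup>2\<close>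
  heaviest ones contain a matching of size \<open>k\<close>, or a star so large that one of its edges can be
  exchanged into any small matching.
\<close>

section \<open>Koenig's theorem\<close>

definition vertex_cover :: "'v set set \<Rightarrow> 'v set \<Rightarrow> bool" where
  "vertex_cover E C \<longleftrightarrow> (\<forall>e\<in>E. e \<inter> C \<noteq> {})"

lemma vertex_cover_remove_edgeD:
  assumes "vertex_cover (E - {e}) C" "e \<inter> C \<noteq> {}"
  shows "vertex_cover E C"
  using assms unfolding vertex_cover_def by blast

lemma bipartite_subset: "bipartite V E \<Longrightarrow> E' \<subseteq> E \<Longrightarrow> bipartite V E'"
  unfolding bipartite_def by (elim exE conjE) (intro exI conjI, auto)

lemma exists_vertex_cover_card_le:
  assumes "finite E" "{} \<notin> E"
  shows "\<exists>C. finite C \<and> vertex_cover E C \<and> card C \<le> card E"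
proof (intro exI conjI)
  let ?v = "\<lambda>e. SOME v. v \<in> e"
  show "vertex_cover E (?v ` E)"
    unfolding vertex_cover_def
  proof
    fix e assume "e \<in> E"
    then have "?v e \<in> e" using assms(2) by (metis equals0I someI)
    then show "e \<inter> ?v ` E \<noteq> {}" using \<open>e \<in> E\<close> by blast
  qed
  show "card (?v ` E) \<le> card E" by (rule card_image_le[OF assms(1)])
qed (use assms(1) in simp)

lemma small_vertex_cover_by_colour_class:
  assumes "bipartite V E" and "finite H" "finite U"
    and meets_or_within: "\<And>e. e \<in> E \<Longrightarrow> e \<inter> U \<noteq> {} \<or> e \<subseteq> H"
  shows "\<exists>C. finite C \<and> vertex_cover E C \<and> 2 * card C \<le> card H + 2 * card U"
proof -
  obtain A B where disjoint: "A \<inter> B = {}" and bip: "\<forall>e\<in>E. \<exists>a\<in>A. \<exists>b\<in>B. e = {a, b}"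
    using assms(1) unfolding bipartite_def by auto
  have cover: "vertex_cover E ((H \<inter> K) \<union> U)" if "K = A \<or> K = B" for K
    unfolding vertex_cover_def
  proof
    fix e assume "e \<in> E"
    with bip obtain a b where "a \<in> A" "b \<in> B" "e = {a, b}" by blast
    then have "e \<inter> K \<noteq> {}" using that by auto
    then show "e \<inter> ((H \<inter> K) \<union> U) \<noteq> {}" using meets_or_within[OF \<open>e \<in> E\<close>] by blast
  qed
  have "card (H \<inter> A) + card (H \<inter> B) = card ((H \<inter> A) \<union> (H \<inter> B))"
    using \<open>finite H\<close> disjoint by (intro card_Un_disjoint[symmetric]) auto
  also have "\<dots> \<le> card H" using \<open>finite H\<close> by (intro card_mono) auto
  finally have "2 * card (H \<inter> A) \<le> card H \<or> 2 * card (H \<inter> B) \<le> card H" by arith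
  then obtain K where K: "K = A \<or> K = B" "2 * card (H \<inter> K) \<le> card H" by blast
  have "2 * card ((H \<inter> K) \<union> U) \<le> card H + 2 * card U"
    using K(2) card_Un_le[of "H \<inter> K" U] by arith
  moreover have "finite ((H \<inter> K) \<union> U)" using \<open>finite H\<close> \<open>finite U\<close> by simp
  ultimately show ?thesis using cover[OF K(1)] by blast
qed

lemma card_sym_diff_add:
  assumes "finite S" "finite T"
  shows "card (sym_diff S T) + 2 * card (S \<inter> T) = card S + card T"
proof -
  have "card (sym_diff S T) = card (S - T) + card (T - S)"
    using assms by (intro card_Un_disjoint) auto
  then show ?thesis
    using card_Int_Diff[OF assms(1), of T] card_Int_Diff[OF assms(2), of S]
    by (simp add: Int_commute)
qed

lemma small_vertex_cover_of_adjacent_edges: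
  assumes bip: "bipartite V E" and adjacent: "e \<noteq> f" "x \<in> e" "x \<in> f"
    and S: "finite S" "vertex_cover (E - {e}) S" "e \<inter> S = {}"
    and T: "finite T" "vertex_cover (E - {f}) T" "f \<inter> T = {}"
  shows "\<exists>C. finite C \<and> vertex_cover E C \<and> 2 * card C \<le> card S + card T + 1"
proof -
  define H where "H = insert x (sym_diff S T)"
  have "g \<inter> (S \<inter> T) \<noteq> {} \<or> g \<subseteq> H" if "g \<in> E" for g
  proof -
    from bip \<open>g \<in> E\<close> obtain a b where g: "g = {a, b}" unfolding bipartite_def by blast
    have meets: "g \<noteq> e \<Longrightarrow> g \<inter> S \<noteq> {}" "g \<noteq> f \<Longrightarrow> g \<inter> T \<noteq> {}"
      using S(2) T(2) that unfolding vertex_cover_def by blast+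
    consider (first) "g = e" | (second) "g = f" | (other) "g \<noteq> e" "g \<noteq> f" by blast
    then show ?thesis
    proof cases
      case first
      then have "g \<inter> (T - S) \<noteq> {}" "x \<notin> T" using meets(2) adjacent S(3) T(3) by auto
      then show ?thesis using first adjacent(2) g by (auto simp: H_def)
    next
      case second
      then have "g \<inter> (S - T) \<noteq> {}" "x \<notin> S" using meets(1) adjacent S(3) T(3) by auto
      then show ?thesis using second adjacent(3) g by (auto simp: H_def)
    next
      case other
      then show ?thesis using meets g by (auto simp: H_def)
    qed
  qed
  moreover have "finite H" "finite (S \<inter> T)" using S(1) T(1) by (simp_all add: H_def)
  ultimately obtain C where "finite C" "vertex_cover E C" "2 * card C \<le> card H + 2 * card (S \<inter> T)"
    using small_vertex_cover_by_colour_class[OF bip, of H "S \<inter> T"] by blast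
  moreover have "card H \<le> card (sym_diff S T) + 1" by (simp add: H_def card_insert_le_m1)
  ultimately show ?thesis
    using card_sym_diff_add[OF S(1) T(1)] by (intro exI[of _ C]) simp
qed

text \<open>
  A graph with two adjacent edges \<open>e\<close> and \<open>f\<close> has covering number at most that of the graph without
  \<open>e\<close> or at most that of the graph without \<open>f\<close>. So deleting edges as long as the covering number is
  preserved leaves a matching.
\<close>

theorem Koenig:
  assumes "finite E" "bipartite V E"
    and "\<And>C. finite C \<Longrightarrow> vertex_cover E C \<Longrightarrow> n \<le> card C"
  shows "\<exists>M\<subseteq>E. matching M \<and> n \<le> card M"
  using assms
proof (induction E rule: finite_psubset_induct)
  case (psubset E)
  note bip = psubset.prems(1) and bound = psubset.prems(2)
  show ?case
  proof (cases "matching E")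
    case True
    have "{} \<notin> E" using bip unfolding bipartite_def by blast
    then have "n \<le> card E"
      using exists_vertex_cover_card_le[OF psubset.hyps] bound le_trans by blast
    then show ?thesis using True by blast
  next
    case False
    then obtain e f x where adjacent: "e \<in> E" "f \<in> E" "e \<noteq> f" "x \<in> e" "x \<in> f"
      unfolding matching_def by blast
    have "\<exists>g\<in>{e, f}. \<forall>C. finite C \<longrightarrow> vertex_cover (E - {g}) C \<longrightarrow> n \<le> card C"
    proof (rule ccontr)
      assume "\<not> ?thesis"
      then obtain S T where S: "finite S" "vertex_cover (E - {e}) S" "card S < n"
        and T: "finite T" "vertex_cover (E - {f}) T" "card T < n"
        by (auto simp: not_le)
      have "e \<inter> S = {}" "f \<inter> T = {}"
        using vertex_cover_remove_edgeD bound S T by (metis not_le)+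
      then obtain C where "finite C" "vertex_cover E C" "2 * card C \<le> card S + card T + 1"
        using small_vertex_cover_of_adjacent_edges[OF bip adjacent(3-5) S(1,2) _ T(1,2)] by blast
      with bound[of C] S(3) T(3) show False by simp
    qed
    then obtain g where g: "g \<in> E" "\<And>C. finite C \<Longrightarrow> vertex_cover (E - {g}) C \<Longrightarrow> n \<le> card C"
      using adjacent(1,2) by blast
    have "\<exists>M\<subseteq>E - {g}. matching M \<and> n \<le> card M"
      by (rule psubset.IH) (use g bipartite_subset[OF bip] in auto)
    then show ?thesis by blast
  qed
qed

corollary exists_vertex_cover_card_less:
  assumes "finite E" "bipartite V E" and "\<nexists>M. M \<subseteq> E \<and> matching M \<and> n \<le> card M"
  shows "\<exists>C\<subseteq>V. card C < n \<and> vertex_cover E C"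
proof -
  obtain C where C: "finite C" "vertex_cover E C" "card C < n"
    using Koenig[OF assms(1,2), of n] assms(3) by (meson not_le)
  have "e \<subseteq> V" if "e \<in> E" for e using assms(2) that unfolding bipartite_def by fastforce
  then have "vertex_cover E (C \<inter> V)" using C(2) unfolding vertex_cover_def by blast
  moreover have "card (C \<inter> V) < n" using C(3) card_mono[OF C(1), of "C \<inter> V"] by simp
  ultimately show ?thesis by blast
qed

section \<open>Decoupling the two requirements\<close>

abbreviation covered_weight :: "('v set \<Rightarrow> nat) \<Rightarrow> 'v set set \<Rightarrow> 'v set \<Rightarrow> nat" where
  "covered_weight w E S \<equiv> sum w (covered_edges E S)"

lemma covered_edges_subset: "covered_edges E S \<subseteq> E"
  by (auto simp: covered_edges_def)

lemma covered_edges_eq_iff_vertex_cover: "covered_edges E C = E \<longleftrightarrow> vertex_cover E C"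
  unfolding covered_edges_def vertex_cover_def by blast

lemma card_le_sum:
  fixes w :: "'a \<Rightarrow> nat"
  assumes "\<And>x. x \<in> M \<Longrightarrow> 0 < w x"
  shows "card M \<le> sum w M"
  using sum_bounded_below[of M 1 w] assms by (simp add: Suc_le_eq)

lemma obtain_max_covered_weight:
  assumes "finite E" "S0 \<subseteq> V" "card S0 \<le> k"
  obtains S where "S \<subseteq> V" "card S \<le> k" "covered_weight w E S0 \<le> covered_weight w E S"
    "\<And>T. T \<subseteq> V \<Longrightarrow> card T \<le> k \<Longrightarrow> covered_weight w E T \<le> covered_weight w E S"
proof -
  let ?P = "\<lambda>T. T \<subseteq> V \<and> card T \<le> k"
  have "covered_weight w E T < sum w E + 1" for T
    using sum_mono2[OF assms(1) covered_edges_subset, of T w] by simp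
  then obtain S where "?P S" "\<forall>T. ?P T \<longrightarrow> covered_weight w E T \<le> covered_weight w E S"
    using assms(2,3) ex_has_greatest_nat[of ?P S0 "covered_weight w E" "sum w E + 1"] by auto
  then show ?thesis using that assms(2,3) by blast
qed

lemma vertex_cover_of_max_covered_weight:
  fixes w :: "'v set \<Rightarrow> nat"
  assumes finE: "finite E" and edge: "\<And>e. e \<in> E \<Longrightarrow> e \<noteq> {} \<and> e \<subseteq> V \<and> 0 < w e"
    and maximal: "\<And>T. T \<subseteq> V \<Longrightarrow> card T \<le> k \<Longrightarrow> covered_weight w E T \<le> covered_weight w E S"
    and C: "C \<subseteq> V" "card C < k" "vertex_cover (covered_edges E S) C"
  shows "vertex_cover E C"
proof (rule ccontr)
  assume "\<not> ?thesis"
  then obtain e where e: "e \<in> E" "e \<inter> C = {}" by (auto simp: vertex_cover_def)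
  then obtain v where v: "v \<in> e" "v \<in> V" using edge by blast
  have fin: "finite (covered_edges E T)" for T
    using finE covered_edges_subset by (rule finite_subset[rotated])
  have "e \<notin> covered_edges E S" using C(3) e(2) by (auto simp: vertex_cover_def)
  then have "covered_weight w E S < sum w (insert e (covered_edges E S))"
    using edge[OF e(1)] fin by simp
  also have "\<dots> \<le> covered_weight w E (insert v C)"
    using C(3) e v by (intro sum_mono2 fin) (auto simp: covered_edges_def vertex_cover_def)
  also have "\<dots> \<le> covered_weight w E S"
    using C(1,2) v by (intro maximal) (auto intro: order_trans[OF card_insert_le_m1])
  finally show False by simp
qed

lemma finite_edges_if_simple_graph: "simple_graph V E \<Longrightarrow> finite E"
  unfolding simple_graph_def by (rule finite_subset[of _ "Pow V"]) auto

lemma exists_covering_set_with_matching: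
  fixes w :: "'v set \<Rightarrow> nat"
  assumes graph: "simple_graph V E" "bipartite V E" and pos: "\<And>e. e \<in> E \<Longrightarrow> 0 < w e"
    and "l \<le> k" and S0: "S0 \<subseteq> V" "card S0 \<le> k"
    and M: "M \<subseteq> E" "matching M" "l \<le> sum w M"
  shows "\<exists>S\<subseteq>V. card S \<le> k \<and> covered_weight w E S0 \<le> covered_weight w E S \<and>
    (\<exists>M\<subseteq>covered_edges E S. matching M \<and> l \<le> sum w M)"
proof -
  have edge: "e \<noteq> {} \<and> e \<subseteq> V \<and> 0 < w e" if "e \<in> E" for e
    using graph(1) pos that by (auto simp: simple_graph_def)
  have finE: "finite E" using graph(1) by (rule finite_edges_if_simple_graph)
  obtain S where S: "S \<subseteq> V" "card S \<le> k" "covered_weight w E S0 \<le> covered_weight w E S"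
    and maximal: "\<And>T. T \<subseteq> V \<Longrightarrow> card T \<le> k \<Longrightarrow> covered_weight w E T \<le> covered_weight w E S"
    using obtain_max_covered_weight[OF finE S0, of w] by blast
  show ?thesis
  proof (cases "\<exists>M\<subseteq>covered_edges E S. matching M \<and> l \<le> card M")
    case True
    then obtain M where "M \<subseteq> covered_edges E S" "matching M" "l \<le> card M" by blast
    moreover from this have "l \<le> sum w M"
      using card_le_sum[of M w] pos covered_edges_subset by (meson le_trans subsetD)
    ultimately show ?thesis using S by blast
  next
    case False
    have "bipartite V (covered_edges E S)" "finite (covered_edges E S)"
      by (rule bipartite_subset[OF graph(2)] finite_subset[OF _ finE], rule covered_edges_subset)+
    then obtain C where C: "C \<subseteq> V" "card C < l" "vertex_cover (covered_edges E S) C"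
      using exists_vertex_cover_card_less[of "covered_edges E S" V l] False by blast
    have "card C < k" using C(2) \<open>l \<le> k\<close> by simp
    have "vertex_cover E C"
      by (rule vertex_cover_of_max_covered_weight[OF finE edge maximal C(1) \<open>card C < k\<close> C(3)])
    then have all: "covered_edges E C = E" by (simp add: covered_edges_eq_iff_vertex_cover)
    have "covered_weight w E S0 \<le> covered_weight w E C"
      unfolding all by (intro sum_mono2 finE covered_edges_subset) simp
    then show ?thesis
      using M C(1) \<open>card C < k\<close> by (intro exI[of _ C]) (simp add: all, blast)
  qed
qed

lemma exists_subset_card_le_sum_ge:
  fixes w :: "'a \<Rightarrow> nat"
  assumes "\<And>x. x \<in> M \<Longrightarrow> 0 < w x" "t \<le> sum w M"
  shows "\<exists>M'\<subseteq>M. card M' \<le> t \<and> t \<le> sum w M'"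
proof (cases "card M \<le> t")
  case False
  then obtain M' where M': "M' \<subseteq> M" "card M' = t"
    using obtain_subset_with_card_n[of t M] by (metis nat_le_linear)
  then have "t \<le> sum w M'" using card_le_sum[of M' w] assms(1) by auto
  then show ?thesis using M' by auto
qed (use assms in auto)

lemma mepvcb_yes_iff:
  assumes I: "mepvcb_instance I" and "k3 I \<le> k1 I"
  shows "mepvcb_yes I \<longleftrightarrow>
    (\<exists>S\<subseteq>verts I. card S \<le> k1 I \<and> k2 I \<le> covered_weight (weight I) (edges I) S) \<and>
    (\<exists>M\<subseteq>edges I. matching M \<and> card M \<le> k1 I \<and> k3 I \<le> sum (weight I) M)"
    (is "_ \<longleftrightarrow> ?covering \<and> ?matching")
proof
  assume "mepvcb_yes I"
  then obtain S M where S: "S \<subseteq> verts I" "card S \<le> k1 I"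
      "k2 I \<le> covered_weight (weight I) (edges I) S"
    and M: "M \<subseteq> covered_edges (edges I) S" "matching M" "k3 I \<le> sum (weight I) M"
    unfolding mepvcb_yes_def by auto
  have "M \<subseteq> edges I" using M(1) covered_edges_subset by (rule order_trans)
  then have "\<And>e. e \<in> M \<Longrightarrow> 0 < weight I e" using I by (auto simp: mepvcb_instance_def)
  then obtain M' where M': "M' \<subseteq> M" "card M' \<le> k3 I" "k3 I \<le> sum (weight I) M'"
    using exists_subset_card_le_sum_ge[OF _ M(3)] by blast
  then have "matching M'" using M(2) unfolding matching_def by blast
  then show "?covering \<and> ?matching"
    using S M' \<open>M \<subseteq> edges I\<close> \<open>k3 I \<le> k1 I\<close> by (meson order_trans)
next
  assume "?covering \<and> ?matching"
  then obtain S M where S: "S \<subseteq> verts I" "card S \<le> k1 I"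
      "k2 I \<le> covered_weight (weight I) (edges I) S"
    and M: "M \<subseteq> edges I" "matching M" "k3 I \<le> sum (weight I) M"
    by blast
  show "mepvcb_yes I"
    using exists_covering_set_with_matching[OF _ _ _ \<open>k3 I \<le> k1 I\<close> S(1,2) M] I S(3) le_trans
    unfolding mepvcb_yes_def mepvcb_instance_def by blast
qed

section \<open>Packings of weighted items\<close>

text \<open>
  An item is an edge \<open>{a, b}\<close> with a weight, or a vertex \<open>v\<close> in the form \<open>(v, v, 0)\<close>. Choosing items
  earns their weights and the weight of all edges of a list \<open>es\<close> that they meet. With vertices for
  items this is the coverage problem; with edges for items and \<open>es = []\<close> it is the matching problem.
\<close>

type_synonym 'v item = "'v \<times> 'v \<times> nat"

abbreviation vertex_item :: "'v \<Rightarrow> 'v item" where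
  "vertex_item v \<equiv> (v, v, 0)"

fun ends :: "'v item \<Rightarrow> 'v set" where
  "ends (a, b, c) = {a, b}"

fun wt :: "'v item \<Rightarrow> nat" where
  "wt (a, b, c) = c"

lemma ends_nonempty [simp]: "ends e \<noteq> {}"
  by (cases e) simp

lemma finite_ends [simp]: "finite (ends e)"
  by (cases e) simp

lemma card_ends_le: "card (ends e) \<le> 2"
  by (cases e) (simp add: card_insert_if)

definition avoiding :: "'v set \<Rightarrow> 'v item list \<Rightarrow> 'v item list" where
  "avoiding S es = filter (\<lambda>e. ends e \<inter> S = {}) es"

definition coverage :: "'v set \<Rightarrow> 'v item list \<Rightarrow> nat" where
  "coverage S es = (\<Sum>e\<leftarrow>filter (\<lambda>e. ends e \<inter> S \<noteq> {}) es. wt e)"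

definition gain :: "'v item set \<Rightarrow> 'v item list \<Rightarrow> nat" where
  "gain X es = (\<Sum>e\<in>X. wt e) + coverage (\<Union>(ends ` X)) es"

lemma set_avoiding: "set (avoiding S es) = {e \<in> set es. ends e \<inter> S = {}}"
  by (simp add: avoiding_def)

lemma coverage_Nil [simp]: "coverage S [] = 0"
  by (simp add: coverage_def)

lemma coverage_Cons:
  "coverage S (e # es) = (if ends e \<inter> S = {} then 0 else wt e) + coverage S es"
  by (simp add: coverage_def)

lemma coverage_empty [simp]: "coverage {} es = 0"
  by (simp add: coverage_def)

lemma coverage_Un: "coverage (S \<union> T) es = coverage S es + coverage T (avoiding S es)"
  by (induction es) (auto simp: coverage_Cons avoiding_def Int_Un_distrib)

lemma coverage_avoiding_le: "coverage S (avoiding T es) \<le> coverage S es"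
  by (induction es) (auto simp: coverage_Cons avoiding_def)

lemma coverage_avoiding_eq:
  assumes "\<And>e. e \<in> set es \<Longrightarrow> ends e \<inter> S = {} \<or> ends e \<inter> T = {}"
  shows "coverage S (avoiding T es) = coverage S es"
  using assms by (induction es) (auto simp: coverage_Cons avoiding_def)

lemma coverage_eq_sum:
  "distinct es \<Longrightarrow> coverage S es = sum wt {e \<in> set es. ends e \<inter> S \<noteq> {}}"
  by (simp add: coverage_def sum_list_distinct_conv_sum_set)

lemma gain_empty [simp]: "gain {} es = 0"
  by (simp add: gain_def)

lemma gain_Nil [simp]: "gain X [] = sum wt X"
  by (simp add: gain_def)

lemma gain_singleton: "gain {e} es = wt e + coverage (ends e) es"
  by (simp add: gain_def)

lemma gain_insert:
  assumes "finite X" "e \<notin> X"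
  shows "gain (insert e X) es = gain {e} es + gain X (avoiding (ends e) es)"
  using assms by (simp add: gain_def coverage_Un)

lemma gain_le_sum_gain: "finite X \<Longrightarrow> gain X es \<le> (\<Sum>e\<in>X. gain {e} es)"
proof (induction X rule: finite_induct)
  case (insert e X)
  have "gain X (avoiding (ends e) es) \<le> gain X es"
    by (simp add: gain_def coverage_avoiding_le)
  then show ?case using insert by (simp add: gain_insert[OF insert.hyps])
qed simp

definition separated :: "'v item set \<Rightarrow> 'v item list \<Rightarrow> bool" where
  "separated X es \<longleftrightarrow> (\<forall>f\<in>set es. \<forall>x\<in>X. \<forall>y\<in>X.
    ends f \<inter> ends x \<noteq> {} \<longrightarrow> ends f \<inter> ends y \<noteq> {} \<longrightarrow> x = y)"

lemma gain_eq_sum_gain: "finite X \<Longrightarrow> separated X es \<Longrightarrow> gain X es = (\<Sum>e\<in>X. gain {e} es)"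
proof (induction X rule: finite_induct)
  case (insert e X)
  have "coverage (\<Union>(ends ` X)) (avoiding (ends e) es) = coverage (\<Union>(ends ` X)) es"
  proof (rule coverage_avoiding_eq)
    fix f assume "f \<in> set es"
    then show "ends f \<inter> \<Union>(ends ` X) = {} \<or> ends f \<inter> ends e = {}"
      using insert.prems insert.hyps(2) unfolding separated_def by blast
  qed
  moreover have "separated X es" using insert.prems by (simp add: separated_def)
  ultimately show ?case
    using insert by (simp add: gain_insert[OF insert.hyps] gain_def[of X])
qed simp

definition heavy_packing :: "nat \<Rightarrow> 'v item list \<Rightarrow> nat \<Rightarrow> 'v item set \<Rightarrow> bool" where
  "heavy_packing k es t X \<longleftrightarrow>
    finite X \<and> disjoint_family_on ends X \<and> card X \<le> k \<and> t \<le> gain X es"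

lemma heavy_packing_insert:
  assumes X: "heavy_packing k (avoiding (ends e) es) (t - gain {e} es) X"
    and disj: "\<And>f. f \<in> X \<Longrightarrow> ends f \<inter> ends e = {}"
  shows "heavy_packing (Suc k) es t (insert e X)"
proof -
  have "e \<notin> X" using disj[of e] by auto
  moreover have "disjoint_family_on ends (insert e X)"
    using X disj \<open>e \<notin> X\<close> by (auto simp: heavy_packing_def disjoint_family_on_insert)
  ultimately show ?thesis
    using X gain_insert[of X e es] by (auto simp: heavy_packing_def card_insert_if)
qed

lemma heavy_packing_remove:
  assumes X: "heavy_packing (Suc k) es t X" and "e \<in> X"
  shows "heavy_packing k (avoiding (ends e) es) (t - gain {e} es) (X - {e})"
    and "\<And>f. f \<in> X - {e} \<Longrightarrow> ends f \<inter> ends e = {}"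
proof -
  have "insert e (X - {e}) = X" using assms(2) by blast
  then have "gain X es = gain {e} es + gain (X - {e}) (avoiding (ends e) es)"
    using X gain_insert[of "X - {e}" e es] by (simp add: heavy_packing_def)
  moreover have "disjoint_family_on ends (X - {e})"
    using X disjoint_family_on_mono[of "X - {e}" X] by (auto simp: heavy_packing_def)
  ultimately show "heavy_packing k (avoiding (ends e) es) (t - gain {e} es) (X - {e})"
    using assms by (auto simp: heavy_packing_def)
  show "ends f \<inter> ends e = {}" if "f \<in> X - {e}" for f
    using X \<open>e \<in> X\<close> that by (auto simp: heavy_packing_def disjoint_family_on_def)
qed

section \<open>The search tree\<close>

fun heaviest_first :: "'v item list \<Rightarrow> 'v item list \<Rightarrow> 'v item list" where
  "heaviest_first es [] = []"
| "heaviest_first es (e # ts) = (case heaviest_first es ts of [] \<Rightarrow> [e]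
    | m # r \<Rightarrow> if gain {e} es < gain {m} es then m # e # r else e # m # r)"

text \<open>
  \<open>k\<close> items may still be taken, \<open>d\<close> discarded before the next one is taken, and \<open>t\<close> is the gain
  still required.
\<close>

fun search :: "nat \<Rightarrow> nat \<Rightarrow> nat \<Rightarrow> 'v item list \<Rightarrow> 'v item list \<Rightarrow> nat \<Rightarrow> bool" where
  "search N 0 d ts es t \<longleftrightarrow> t = 0"
| "search N (Suc k) 0 ts es t \<longleftrightarrow> t = 0"
| "search N (Suc k) (Suc d) ts es t \<longleftrightarrow> t = 0 \<or> (case heaviest_first es ts of [] \<Rightarrow> False
    | m # r \<Rightarrow> search N k N (avoiding (ends m) r) (avoiding (ends m) es) (t - gain {m} es) \<or>
        search N (Suc k) d r es t)"

lemma mset_heaviest_first [simp]: "mset (heaviest_first es ts) = mset ts"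
  by (induction ts) (auto split: list.split)

lemma heaviest_first_eq_Nil_iff [simp]: "heaviest_first es ts = [] \<longleftrightarrow> ts = []"
  by (metis mset_heaviest_first mset_zero_iff)

lemma heaviest_first_eq_ConsD:
  assumes "heaviest_first es ts = m # r"
  shows "set ts = insert m (set r)" "length ts = Suc (length r)"
    "distinct ts \<longleftrightarrow> m \<notin> set r \<and> distinct r"
proof -
  have mset: "mset ts = mset (m # r)" using assms mset_heaviest_first by metis
  show "set ts = insert m (set r)" using mset_eq_setD[OF mset] by simp
  show "length ts = Suc (length r)" using mset_eq_length[OF mset] by simp
  show "distinct ts \<longleftrightarrow> m \<notin> set r \<and> distinct r"
    using mset_eq_imp_distinct_iff[OF mset] by simp
qed

lemma heaviest_first_max:
  "heaviest_first es ts = m # r \<Longrightarrow> x \<in> set r \<Longrightarrow> gain {x} es \<le> gain {m} es"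
proof (induction ts arbitrary: m r x)
  case (Cons e ts)
  show ?case
  proof (cases "heaviest_first es ts")
    case Nil
    then show ?thesis using Cons.prems by simp
  next
    case (Cons m' r')
    note max = Cons.IH[OF Cons]
    have split: "m # r = (if gain {e} es < gain {m'} es then m' # e # r' else e # m' # r')"
      using Cons.prems(1) Cons by simp
    show ?thesis
    proof (cases "gain {e} es < gain {m'} es")
      case True
      then show ?thesis using split max[of x] Cons.prems(2) by (cases "x = e") simp_all
    next
      case False
      then show ?thesis using split max[of x] Cons.prems(2) by (cases "x = m'") simp_all
    qed
  qed
qed simp

lemma search_sound:
  "search N k d ts es t \<Longrightarrow> \<exists>X\<subseteq>set ts. heavy_packing k es t X"
proof (induction N k d ts es t rule: search.induct)
  case (3 N k d ts es t)
  show ?case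
  proof (cases "t = 0")
    case False
    then obtain m r where first: "heaviest_first es ts = m # r"
      and branch: "search N k N (avoiding (ends m) r) (avoiding (ends m) es) (t - gain {m} es) \<or>
        search N (Suc k) d r es t"
      using "3.prems" by (auto split: list.splits)
    note ts_eq = heaviest_first_eq_ConsD(1)[OF first]
    from branch show ?thesis
    proof
      assume "search N k N (avoiding (ends m) r) (avoiding (ends m) es) (t - gain {m} es)"
      then obtain X where "X \<subseteq> set (avoiding (ends m) r)"
        "heavy_packing k (avoiding (ends m) es) (t - gain {m} es) X"
        using "3.IH"(1)[OF first] by blast
      then have "insert m X \<subseteq> set ts" "heavy_packing (Suc k) es t (insert m X)"
        by (auto simp: set_avoiding ts_eq intro!: heavy_packing_insert)
      then show ?thesis by blast
    next
      assume "search N (Suc k) d r es t"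
      then show ?thesis using "3.IH"(2)[OF first] ts_eq by blast
    qed
  qed (auto simp: heavy_packing_def disjoint_family_on_def intro!: exI[of _ "{}"])
qed (auto simp: heavy_packing_def disjoint_family_on_def intro!: exI[of _ "{}"])

fun heaviest :: "nat \<Rightarrow> 'v item list \<Rightarrow> 'v item list \<Rightarrow> 'v item set" where
  "heaviest 0 es ts = {}"
| "heaviest (Suc d) es ts =
    (case heaviest_first es ts of [] \<Rightarrow> {} | m # r \<Rightarrow> insert m (heaviest d es r))"

definition dominating :: "nat \<Rightarrow> 'v item list \<Rightarrow> 'v item set \<Rightarrow> 'v item set \<Rightarrow> bool" where
  "dominating N es H T \<longleftrightarrow> H \<subseteq> T \<and> (N \<le> card H \<or> H = T) \<and>
    (\<forall>x\<in>H. \<forall>y\<in>T - H. gain {y} es \<le> gain {x} es)"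

lemma dominating_heaviest: "distinct ts \<Longrightarrow> dominating d es (heaviest d es ts) (set ts)"
proof (induction d arbitrary: ts)
  case (Suc d)
  show ?case
  proof (cases "heaviest_first es ts")
    case (Cons m r)
    note ts_eq = heaviest_first_eq_ConsD[OF Cons]
    have r: "dominating d es (heaviest d es r) (set r)" using Suc ts_eq(3) by blast
    then have sub: "heaviest d es r \<subseteq> set r" by (simp add: dominating_def)
    then have "finite (heaviest d es r)" "m \<notin> heaviest d es r"
      using finite_subset Suc.prems ts_eq(3) by auto
    then show ?thesis
      using r heaviest_first_max[OF Cons] by (auto simp: dominating_def Cons ts_eq(1))
  qed (simp add: dominating_def)
qed (simp add: dominating_def)

lemma search_if_meets_heaviest:
  assumes "X \<subseteq> set ts" "X \<inter> heaviest d es ts \<noteq> {}" "distinct ts"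
    and "\<And>m r. m \<in> X \<Longrightarrow> X - {m} \<subseteq> set r \<Longrightarrow> set r \<subseteq> set ts \<Longrightarrow> distinct r \<Longrightarrow>
      search N k N (avoiding (ends m) r) (avoiding (ends m) es) (t - gain {m} es)"
  shows "search N (Suc k) d ts es t"
  using assms
proof (induction d arbitrary: ts)
  case (Suc d)
  then obtain m r where first: "heaviest_first es ts = m # r"
    by (auto split: list.splits)
  note ts_eq = heaviest_first_eq_ConsD[OF first]
  show ?case
  proof (cases "m \<in> X")
    case True
    have "search N k N (avoiding (ends m) r) (avoiding (ends m) es) (t - gain {m} es)"
      using Suc.prems(1,3) ts_eq by (intro Suc.prems(4) True) auto
    then show ?thesis using first by simp
  next
    case False
    have "search N (Suc k) d r es t"
    proof (rule Suc.IH)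
      show "X \<subseteq> set r" "distinct r" "X \<inter> heaviest d es r \<noteq> {}"
        using Suc.prems(1-3) ts_eq first False by auto
      show "search N k N (avoiding (ends m') r') (avoiding (ends m') es) (t - gain {m'} es)"
        if "m' \<in> X" "X - {m'} \<subseteq> set r'" "set r' \<subseteq> set r" "distinct r'" for m' r'
        using Suc.prems(4) that ts_eq(1) by blast
    qed
    then show ?thesis using first by simp
  qed
qed simp

lemma search_complete:
  assumes step: "\<And>k ts es e r. Inv (Suc k) ts es \<Longrightarrow> distinct r \<Longrightarrow> set r \<subseteq> set ts \<Longrightarrow>
      Inv k (avoiding (ends e) r) (avoiding (ends e) es)"
    and dist: "\<And>k ts es. Inv k ts es \<Longrightarrow> distinct ts"
    and exchange: "\<And>k ts es t H X. Inv k ts es \<Longrightarrow> dominating N es H (set ts) \<Longrightarrow> X \<noteq> {} \<Longrightarrow>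
      X \<subseteq> set ts \<Longrightarrow> heavy_packing k es t X \<Longrightarrow> \<exists>Y\<subseteq>set ts. heavy_packing k es t Y \<and> Y \<inter> H \<noteq> {}"
    and "Inv k ts es" "X \<subseteq> set ts" "heavy_packing k es t X"
  shows "search N k N ts es t"
  using assms(4-6)
proof (induction k arbitrary: ts es t X)
  case 0
  then show ?case by (auto simp: heavy_packing_def)
next
  case (Suc k)
  show ?case
  proof (cases "X = {}")
    case True
    then have "t = 0" using Suc.prems(3) by (simp add: heavy_packing_def)
    then show ?thesis by (cases N) simp_all
  next
    case False
    note dominating = dominating_heaviest[OF dist[OF Suc.prems(1)], of N es]
    obtain Y where Y: "Y \<subseteq> set ts" "heavy_packing (Suc k) es t Y" "Y \<inter> heaviest N es ts \<noteq> {}"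
      using exchange[OF Suc.prems(1) dominating False Suc.prems(2,3)] by blast
    show ?thesis
    proof (rule search_if_meets_heaviest[OF Y(1,3) dist[OF Suc.prems(1)]])
      fix m r assume m: "m \<in> Y" and r: "Y - {m} \<subseteq> set r" "set r \<subseteq> set ts" "distinct r"
      note rest = heavy_packing_remove[OF Y(2) m]
      have "Y - {m} \<subseteq> set (avoiding (ends m) r)"
        using r(1) rest(2) by (auto simp: set_avoiding)
      then show "search N k N (avoiding (ends m) r) (avoiding (ends m) es) (t - gain {m} es)"
        using Suc.IH[OF step[OF Suc.prems(1) r(3,2)] _ rest(1)] by blast
    qed
  qed
qed

section \<open>Exchange arguments\<close>

lemma sum_le_sum_if_dominated:
  fixes f :: "'a \<Rightarrow> nat"
  assumes "finite S" "finite I" "card S \<le> card I" "\<And>s x. s \<in> S \<Longrightarrow> x \<in> I \<Longrightarrow> f s \<le> f x"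
  shows "sum f S \<le> sum f I"
proof (cases "I = {}")
  case False
  define m where "m = Min (f ` I)"
  have m: "m \<in> f ` I" unfolding m_def using assms(2) False by (intro Min_in) auto
  have "sum f S \<le> card S * m"
    using assms(4) m by (intro sum_bounded_above[where K = m, simplified]) auto
  also have "\<dots> \<le> card I * m" using assms(3) by simp
  also have "\<dots> \<le> sum f I"
    using assms(2) by (intro sum_bounded_below[where K = m, simplified]) (auto simp: m_def)
  finally show ?thesis .
qed (use assms in simp)

lemma heavy_packing_bound_pos: "heavy_packing k es t X \<Longrightarrow> X \<noteq> {} \<Longrightarrow> 0 < k"
  by (metis heavy_packing_def card_gt_0_iff less_le_trans)

lemma heavy_packing_of_dominating:
  assumes X: "heavy_packing k es t X" "X \<subseteq> T" "X \<inter> H = {}"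
    and H: "dominating N es H T"
    and Q: "Q \<subseteq> H" "finite Q" "card Q = k" "disjoint_family_on ends Q" "separated Q es"
  shows "heavy_packing k es t Q"
proof -
  have "t \<le> gain X es" using X(1) by (simp add: heavy_packing_def)
  also have "\<dots> \<le> (\<Sum>e\<in>X. gain {e} es)"
    using X(1) by (intro gain_le_sum_gain) (simp add: heavy_packing_def)
  also have "\<dots> \<le> (\<Sum>e\<in>Q. gain {e} es)"
  proof (rule sum_le_sum_if_dominated)
    show "gain {x} es \<le> gain {q} es" if "x \<in> X" "q \<in> Q" for x q
      using that X(2,3) Q(1) H unfolding dominating_def by blast
  qed (use X(1) Q in \<open>simp_all add: heavy_packing_def\<close>)
  also have "\<dots> = gain Q es" using Q by (intro gain_eq_sum_gain[symmetric])
  finally show ?thesis using Q by (simp add: heavy_packing_def)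
qed

subsection \<open>Vertices\<close>

lemma obtain_monochromatic_subset:
  fixes side :: "'a \<Rightarrow> bool"
  assumes "finite D" "2 * k \<le> card D"
  obtains I where "I \<subseteq> D" "card I = k" "\<forall>x\<in>I. \<forall>y\<in>I. side x = side y"
proof -
  let ?D = "\<lambda>c. {x \<in> D. side x = c}"
  have "card (?D True) + card (?D False) = card (?D True \<union> ?D False)"
    using assms(1) by (intro card_Un_disjoint[symmetric]) auto
  also have "?D True \<union> ?D False = D" by auto
  finally have "k \<le> card (?D True) \<or> k \<le> card (?D False)" using assms(2) by linarith
  then obtain c where "k \<le> card (?D c)" by blast
  then obtain I where "I \<subseteq> {x \<in> D. side x = c}" "card I = k"
    by (rule obtain_subset_with_card_n)
  then show ?thesis by (intro that[of I]) blast+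
qed

lemma separated_if_monochromatic:
  fixes side :: "'v \<Rightarrow> bool"
  assumes bip: "\<And>a b c. (a, b, c) \<in> set es \<Longrightarrow> side a \<noteq> side b"
    and "X \<subseteq> range vertex_item" and mono: "\<forall>x\<in>X. \<forall>y\<in>X. side (fst x) = side (fst y)"
  shows "separated X es"
  unfolding separated_def
proof (intro ballI impI)
  fix f x y assume "f \<in> set es" and xy: "x \<in> X" "y \<in> X"
    and meets: "ends f \<inter> ends x \<noteq> {}" "ends f \<inter> ends y \<noteq> {}"
  obtain u v where items: "x = vertex_item u" "y = vertex_item v" using xy assms(2) by blast
  obtain a b c where f: "f = (a, b, c)" by (cases f)
  then have "side a \<noteq> side b" using bip \<open>f \<in> set es\<close> by blast
  moreover have "u \<in> {a, b}" "v \<in> {a, b}" using meets by (auto simp: items f)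
  moreover have "side u = side v" using bspec[OF bspec[OF mono xy(1)] xy(2)] by (simp add: items)
  ultimately show "x = y" by (auto simp: items)
qed

lemma disjoint_family_on_vertex_items:
  assumes "X \<subseteq> range vertex_item"
  shows "disjoint_family_on ends X"
  unfolding disjoint_family_on_def
proof (intro ballI impI)
  fix x y assume "x \<in> X" "y \<in> X" "x \<noteq> y"
  moreover from this obtain u v where "x = vertex_item u" "y = vertex_item v"
    using assms by blast
  ultimately show "ends x \<inter> ends y = {}" by simp
qed

lemma vertex_exchange:
  fixes side :: "'v \<Rightarrow> bool"
  assumes T: "finite T" "T \<subseteq> range vertex_item" and "2 * k \<le> N"
    and bip: "\<And>a b c. (a, b, c) \<in> set es \<Longrightarrow> side a \<noteq> side b"
    and H: "dominating N es H T" and X: "X \<subseteq> T" "X \<noteq> {}" "heavy_packing k es t X"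
  shows "\<exists>Y\<subseteq>T. heavy_packing k es t Y \<and> Y \<inter> H \<noteq> {}"
proof (cases "X \<inter> H = {}")
  case True
  have "finite H" using H T(1) finite_subset by (auto simp: dominating_def)
  moreover have "2 * k \<le> card H"
    using H True X(1,2) \<open>2 * k \<le> N\<close> by (auto simp: dominating_def)
  ultimately obtain Q where Q: "Q \<subseteq> H" "card Q = k"
    and mono: "\<forall>x\<in>Q. \<forall>y\<in>Q. side (fst x) = side (fst y)"
    by (rule obtain_monochromatic_subset[where side = "\<lambda>x. side (fst x)"])
  have "Q \<subseteq> T" using Q(1) H by (auto simp: dominating_def)
  then have "finite Q" "Q \<subseteq> range vertex_item" using T(1) T(2) by (auto intro: finite_subset)
  then have "heavy_packing k es t Q"
    using heavy_packing_of_dominating[OF X(3,1) True H Q(1) _ Q(2)]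
      disjoint_family_on_vertex_items[of Q] separated_if_monochromatic[OF bip _ mono] by simp
  moreover have "Q \<noteq> {}" using Q(2) heavy_packing_bound_pos[OF X(3,2)] by auto
  ultimately show ?thesis using Q(1) \<open>Q \<subseteq> T\<close> by blast
qed (use X in blast)

subsection \<open>Edges\<close>

lemma obtain_maximal_disjoint_subfamily:
  assumes "finite D" and nonempty: "\<And>e. e \<in> D \<Longrightarrow> A e \<noteq> {}"
  obtains Q where "Q \<subseteq> D" "disjoint_family_on A Q" "\<forall>e\<in>D. A e \<inter> \<Union>(A ` Q) \<noteq> {}"
proof -
  let ?P = "\<lambda>Q. Q \<subseteq> D \<and> disjoint_family_on A Q"
  have "?P {}" by (simp add: disjoint_family_on_def)
  moreover have "\<forall>Q. ?P Q \<longrightarrow> card Q < card D + 1"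
    using card_mono[OF \<open>finite D\<close>] by (simp add: less_Suc_eq_le)
  ultimately obtain Q where Q: "?P Q" "\<And>Q'. ?P Q' \<Longrightarrow> card Q' \<le> card Q"
    using ex_has_greatest_nat[of ?P "{}" card "card D + 1"] by blast
  have "A e \<inter> \<Union>(A ` Q) \<noteq> {}" if "e \<in> D" for e
  proof
    assume disjoint: "A e \<inter> \<Union>(A ` Q) = {}"
    then have "e \<notin> Q" using nonempty[OF that] by blast
    then have "?P (insert e Q)"
      using Q(1) that disjoint by (simp add: disjoint_family_on_insert)
    then have "card (insert e Q) \<le> card Q" by (rule Q(2))
    then show False using \<open>e \<notin> Q\<close> Q(1) finite_subset[OF _ \<open>finite D\<close>] by auto
  qed
  then show ?thesis using Q(1) by (intro that[of Q]) auto
qed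

lemma disjoint_subfamily_or_star:
  fixes A :: "'a \<Rightarrow> 'v set"
  assumes D: "finite D" "k * r * m < card D"
    and member: "\<And>e. e \<in> D \<Longrightarrow> A e \<noteq> {} \<and> finite (A e) \<and> card (A e) \<le> r"
  shows "(\<exists>Q\<subseteq>D. disjoint_family_on A Q \<and> k < card Q) \<or> (\<exists>u. m < card {e \<in> D. u \<in> A e})"
proof -
  have "\<And>e. e \<in> D \<Longrightarrow> A e \<noteq> {}" using member by blast
  then obtain Q where Q: "Q \<subseteq> D" "disjoint_family_on A Q"
    and meets: "\<forall>e\<in>D. A e \<inter> \<Union>(A ` Q) \<noteq> {}"
    by (rule obtain_maximal_disjoint_subfamily[OF D(1)])
  have "k < card Q" if small: "\<And>u. card {e \<in> D. u \<in> A e} \<le> m"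
  proof (rule ccontr)
    assume "\<not> k < card Q"
    have finQ: "finite Q" using Q(1) D(1) by (rule finite_subset)
    have "card (\<Union>(A ` Q)) \<le> (\<Sum>e\<in>Q. card (A e))" by (rule card_UN_le[OF finQ])
    also have "\<dots> \<le> card Q * r"
      using member Q(1) by (intro sum_bounded_above[where K = r, simplified]) auto
    also have "\<dots> \<le> k * r" using \<open>\<not> k < card Q\<close> by simp
    finally have points: "card (\<Union>(A ` Q)) \<le> k * r" .
    have "D \<subseteq> (\<Union>v\<in>\<Union>(A ` Q). {e \<in> D. v \<in> A e})" using meets by blast
    then have "card D \<le> card (\<Union>v\<in>\<Union>(A ` Q). {e \<in> D. v \<in> A e})"
      by (rule card_mono[OF finite_subset[OF _ D(1)], rotated]) blast
    also have "\<dots> \<le> (\<Sum>v\<in>\<Union>(A ` Q). card {e \<in> D. v \<in> A e})"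
      using finQ member Q(1) by (intro card_UN_le) blast
    also have "\<dots> \<le> card (\<Union>(A ` Q)) * m"
      using small by (intro sum_bounded_above[where K = m, simplified]) simp
    also have "\<dots> \<le> k * r * m" using points by (rule mult_right_mono) simp
    finally show False using D(2) by simp
  qed
  then show ?thesis using Q not_le by metis
qed

lemma exists_star_edge_avoiding:
  assumes inj: "inj_on ends D" and S: "finite S" "card S < card {e \<in> D. u \<in> ends e}"
  shows "\<exists>f\<in>D. u \<in> ends f \<and> ends f \<inter> S \<subseteq> {u}"
proof (rule ccontr)
  assume none: "\<not> ?thesis"
  let ?star = "{e \<in> D. u \<in> ends e}"
  have "ends ` ?star \<subseteq> (\<lambda>x. {u, x}) ` S"
  proof
    fix g assume "g \<in> ends ` ?star"
    then obtain e where e: "g = ends e" "e \<in> D" "u \<in> ends e" by blast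
    then obtain x where x: "x \<in> ends e" "x \<in> S" "x \<noteq> u" using none by blast
    then have "g = {u, x}" using e(1,3) by (cases e) auto
    then show "g \<in> (\<lambda>x. {u, x}) ` S" using x(2) by blast
  qed
  then have "card (ends ` ?star) \<le> card S" using S(1) surj_card_le by blast
  moreover have "card (ends ` ?star) = card ?star"
    using inj by (intro card_image) (auto intro: inj_on_subset)
  ultimately show False using S(2) by simp
qed

lemma heavy_packing_exchange_star_edge:
  assumes X: "heavy_packing k [] t X" "X \<noteq> {}" and f: "f \<notin> X" "ends f \<inter> \<Union>(ends ` X) \<subseteq> {u}"
    and dominated: "\<And>e. e \<in> X \<Longrightarrow> wt e \<le> wt f"
  shows "\<exists>Y\<subseteq>insert f X. f \<in> Y \<and> heavy_packing k [] t Y"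
proof -
  have packing: "finite X" "disjoint_family_on ends X" "card X \<le> k" "t \<le> sum wt X"
    using X(1) by (simp_all add: heavy_packing_def)
  obtain e where e: "e \<in> X" "\<And>g. g \<in> X - {e} \<Longrightarrow> u \<notin> ends g"
  proof (cases "\<exists>e\<in>X. u \<in> ends e")
    case True
    then show ?thesis using that packing(2) unfolding disjoint_family_on_def by blast
  qed (use that X(2) in blast)
  let ?Y = "insert f (X - {e})"
  have "disjoint_family_on ends (X - {e})"
    using packing(2) by (rule disjoint_family_on_mono[rotated]) blast
  moreover have "ends f \<inter> \<Union>(ends ` (X - {e})) = {}" using f(2) e(2) by blast
  ultimately have "disjoint_family_on ends ?Y"
    using f(1) by (simp add: disjoint_family_on_insert)
  moreover have "card ?Y = card X"
    using packing(1) f(1) e(1) card_Suc_Diff1[of X e] by simp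
  moreover have "sum wt X \<le> sum wt ?Y"
    using packing(1) f(1) e(1) dominated[OF e(1)] by (simp add: sum.remove[of X e])
  ultimately have "heavy_packing k [] t ?Y" using packing by (simp add: heavy_packing_def)
  then show ?thesis by (intro exI[of _ ?Y]) auto
qed

lemma heavy_packing_exchange_star:
  assumes inj: "inj_on ends T" and H: "dominating N [] H T"
    and X: "X \<subseteq> T" "X \<noteq> {}" "heavy_packing k [] t X" "X \<inter> H = {}"
    and star: "2 * k < card {e \<in> H. u \<in> ends e}"
  shows "\<exists>Y\<subseteq>T. heavy_packing k [] t Y \<and> Y \<inter> H \<noteq> {}"
proof -
  have HT: "H \<subseteq> T" using H by (simp add: dominating_def)
  have finX: "finite X" "card X \<le> k" using X(3) by (simp_all add: heavy_packing_def)
  have "card (\<Union>(ends ` X)) \<le> (\<Sum>e\<in>X. card (ends e))" by (rule card_UN_le[OF finX(1)])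
  also have "\<dots> \<le> (\<Sum>e\<in>X. 2)" by (intro sum_mono card_ends_le)
  also have "\<dots> < card {e \<in> H. u \<in> ends e}" using finX(2) star by simp
  finally have "card (\<Union>(ends ` X)) < card {e \<in> H. u \<in> ends e}" .
  moreover have "inj_on ends H" using inj HT by (rule inj_on_subset)
  ultimately obtain f where f: "f \<in> H" "ends f \<inter> \<Union>(ends ` X) \<subseteq> {u}"
    using exists_star_edge_avoiding[of H "\<Union>(ends ` X)" u] finX(1) by auto
  have "wt e \<le> wt f" if "e \<in> X" for e
  proof -
    have "gain {e} [] \<le> gain {f} []"
      using H f(1) that X(1,4) unfolding dominating_def by blast
    then show ?thesis by simp
  qed
  moreover have "f \<notin> X" using f(1) X(4) by blast
  ultimately obtain Y where "Y \<subseteq> insert f X" "f \<in> Y" "heavy_packing k [] t Y"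
    using heavy_packing_exchange_star_edge[OF X(3,2) _ f(2)] by blast
  then show ?thesis using f(1) HT X(1) by blast
qed

lemma edge_exchange:
  assumes T: "finite T" "inj_on ends T" and "4 * k\<^sup>2 < N"
    and H: "dominating N [] H T" and X: "X \<subseteq> T" "X \<noteq> {}" "heavy_packing k [] t X"
  shows "\<exists>Y\<subseteq>T. heavy_packing k [] t Y \<and> Y \<inter> H \<noteq> {}"
proof (cases "X \<inter> H = {}")
  case True
  have HT: "H \<subseteq> T" "finite H" using H T(1) finite_subset by (auto simp: dominating_def)
  have "k * 2 * (2 * k) < card H"
    using H True X(1,2) \<open>4 * k\<^sup>2 < N\<close> by (auto simp: dominating_def power2_eq_square)
  then have "(\<exists>Q\<subseteq>H. disjoint_family_on ends Q \<and> k < card Q) \<or>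
      (\<exists>u. 2 * k < card {e \<in> H. u \<in> ends e})"
    using HT(2) by (intro disjoint_subfamily_or_star[where r = 2]) (simp_all add: card_ends_le)
  then consider (matching) Q where "Q \<subseteq> H" "disjoint_family_on ends Q" "k < card Q"
    | (star) u where "2 * k < card {e \<in> H. u \<in> ends e}"
    by blast
  then show ?thesis
  proof cases
    case matching
    obtain Q' where Q': "Q' \<subseteq> Q" "card Q' = k" "finite Q'"
      by (rule obtain_subset_with_card_n[OF less_imp_le[OF matching(3)]])
    have "disjoint_family_on ends Q'" using Q'(1) matching(2) by (rule disjoint_family_on_mono)
    then have "heavy_packing k [] t Q'"
      using Q' matching(1)
      by (intro heavy_packing_of_dominating[OF X(3,1) True H]) (auto simp: separated_def)
    moreover have "Q' \<noteq> {}" using Q'(2) heavy_packing_bound_pos[OF X(3,2)] by auto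
    ultimately show ?thesis using Q'(1) matching(1) HT(1) by blast
  next
    case star
    then show ?thesis by (rule heavy_packing_exchange_star[OF T(2) H X True])
  qed
qed (use X in blast)

section \<open>Correctness of the search\<close>

abbreviation vertex_items :: "'v list \<Rightarrow> 'v item list" where
  "vertex_items \<equiv> map vertex_item"

lemma heavy_packing_vertex_items_iff:
  assumes "finite S"
  shows "heavy_packing k es t (vertex_item ` S) \<longleftrightarrow> card S \<le> k \<and> t \<le> coverage S es"
proof -
  have "inj_on vertex_item S" by (simp add: inj_on_def)
  then have "gain (vertex_item ` S) es = coverage S es" "card (vertex_item ` S) = card S"
    by (simp_all add: gain_def sum.reindex card_image)
  moreover have "disjoint_family_on ends (vertex_item ` S)"
    by (rule disjoint_family_on_vertex_items) blast
  ultimately show ?thesis using assms by (simp add: heavy_packing_def)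
qed

lemma search_vertex_items_iff:
  fixes side :: "'v \<Rightarrow> bool"
  assumes "distinct vs" "2 * k \<le> N"
    and bip: "\<And>a b c. (a, b, c) \<in> set es \<Longrightarrow> side a \<noteq> side b"
  shows "search N k N (vertex_items vs) es t \<longleftrightarrow> (\<exists>S\<subseteq>set vs. card S \<le> k \<and> t \<le> coverage S es)"
proof -
  have "search N k N (vertex_items vs) es t \<longleftrightarrow>
      (\<exists>X\<subseteq>set (vertex_items vs). heavy_packing k es t X)"
  proof
    let ?Inv = "\<lambda>k ts es. 2 * k \<le> N \<and> distinct ts \<and> set ts \<subseteq> range vertex_item \<and>
      (\<forall>(a, b, c)\<in>set es. side a \<noteq> side b)"
    assume "\<exists>X\<subseteq>set (vertex_items vs). heavy_packing k es t X"
    then obtain X where X: "X \<subseteq> set (vertex_items vs)" "heavy_packing k es t X" by blast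
    show "search N k N (vertex_items vs) es t"
    proof (rule search_complete[where Inv = ?Inv, OF _ _ _ _ X])
      show "?Inv k (vertex_items vs) es"
        using assms by (auto simp: distinct_map inj_on_def)
      show "?Inv k (avoiding (ends e) r) (avoiding (ends e) es)"
        if "?Inv (Suc k) ts es" "distinct r" "set r \<subseteq> set ts" for k ts es e r
        using that by (fastforce simp: avoiding_def)
      show "\<exists>Y\<subseteq>set ts. heavy_packing k es t Y \<and> Y \<inter> H \<noteq> {}"
        if "?Inv k ts es" "dominating N es H (set ts)" "X \<noteq> {}" "X \<subseteq> set ts"
          "heavy_packing k es t X" for k ts es t H X
        using that by (intro vertex_exchange[where side = side and X = X and N = N]) auto
    qed simp
  qed (rule search_sound)
  also have "\<dots> \<longleftrightarrow> (\<exists>S\<subseteq>set vs. heavy_packing k es t (vertex_item ` S))"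
    by (auto simp: subset_image_iff)
  also have "\<dots> \<longleftrightarrow> (\<exists>S\<subseteq>set vs. card S \<le> k \<and> t \<le> coverage S es)"
    using heavy_packing_vertex_items_iff finite_subset by blast
  finally show ?thesis .
qed

lemma search_edges_iff:
  assumes "distinct es" "inj_on ends (set es)" "4 * k\<^sup>2 < N"
  shows "search N k N es [] t \<longleftrightarrow>
    (\<exists>M\<subseteq>set es. disjoint_family_on ends M \<and> card M \<le> k \<and> t \<le> sum wt M)"
proof -
  have "search N k N es [] t \<longleftrightarrow> (\<exists>M\<subseteq>set es. heavy_packing k [] t M)"
  proof
    let ?Inv = "\<lambda>k ts es. 4 * k\<^sup>2 < N \<and> distinct ts \<and> inj_on ends (set ts) \<and> es = []"
    assume "\<exists>M\<subseteq>set es. heavy_packing k [] t M"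
    then obtain M where M: "M \<subseteq> set es" "heavy_packing k [] t M" by blast
    show "search N k N es [] t"
    proof (rule search_complete[where Inv = ?Inv, OF _ _ _ _ M])
      show "?Inv k (avoiding (ends e) r) (avoiding (ends e) es)"
        if "?Inv (Suc k) ts es" "distinct r" "set r \<subseteq> set ts" for k ts es e r
      proof -
        have "4 * k\<^sup>2 \<le> 4 * (Suc k)\<^sup>2" by (simp add: power_mono)
        then have "4 * k\<^sup>2 < N" using that(1) by linarith
        moreover have "inj_on ends (set (avoiding (ends e) r))"
          using that by (auto simp: set_avoiding intro: inj_on_subset)
        ultimately show ?thesis using that by (auto simp: avoiding_def)
      qed
      show "\<exists>Y\<subseteq>set ts. heavy_packing k es t Y \<and> Y \<inter> H \<noteq> {}"
        if "?Inv k ts es" "dominating N es H (set ts)" "X \<noteq> {}" "X \<subseteq> set ts"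
          "heavy_packing k es t X" for k ts es t H X
        using that edge_exchange[of "set ts" k N H X t] by blast
    qed (use assms in simp_all)
  qed (rule search_sound)
  then show ?thesis
    unfolding heavy_packing_def by (metis List.finite_set finite_subset gain_Nil)
qed

definition lists_instance :: "mepvcb \<Rightarrow> nat list \<Rightarrow> nat item list \<Rightarrow> bool" where
  "lists_instance I vs es \<longleftrightarrow> distinct vs \<and> set vs = verts I \<and>
    distinct (map ends es) \<and> ends ` set es = edges I \<and> (\<forall>e\<in>set es. wt e = weight I (ends e))"

lemma sum_weight_ends:
  assumes "lists_instance I vs es" "M \<subseteq> set es"
  shows "sum (weight I) (ends ` M) = sum wt M"
proof -
  have "inj_on ends M"
    using assms by (auto simp: lists_instance_def distinct_map intro: inj_on_subset)
  then have "sum (weight I) (ends ` M) = (\<Sum>e\<in>M. weight I (ends e))" by (simp add: sum.reindex)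
  also have "\<dots> = sum wt M"
    using assms unfolding lists_instance_def by (intro sum.cong) (metis subsetD)+
  finally show ?thesis .
qed

lemma covered_weight_eq_coverage:
  assumes "lists_instance I vs es"
  shows "covered_weight (weight I) (edges I) S = coverage S es"
proof -
  have edges: "edges I = ends ` set es" using assms by (simp add: lists_instance_def)
  have "covered_edges (edges I) S = ends ` {e \<in> set es. ends e \<inter> S \<noteq> {}}"
    unfolding covered_edges_def edges by blast
  then have "covered_weight (weight I) (edges I) S = sum wt {e \<in> set es. ends e \<inter> S \<noteq> {}}"
    using sum_weight_ends[OF assms, of "{e \<in> set es. ends e \<inter> S \<noteq> {}}"] by simp
  also have "\<dots> = coverage S es"
    using assms by (intro coverage_eq_sum[symmetric]) (simp add: lists_instance_def distinct_map)
  finally show ?thesis .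
qed

lemma exists_matching_iff:
  assumes I: "lists_instance I vs es"
  shows "(\<exists>M\<subseteq>edges I. matching M \<and> card M \<le> k \<and> t \<le> sum (weight I) M) \<longleftrightarrow>
    (\<exists>M\<subseteq>set es. disjoint_family_on ends M \<and> card M \<le> k \<and> t \<le> sum wt M)"
proof -
  have image: "matching (ends ` M) \<longleftrightarrow> disjoint_family_on ends M"
    "card (ends ` M) = card M" "sum (weight I) (ends ` M) = sum wt M" if "M \<subseteq> set es" for M
  proof -
    have "inj_on ends M"
      using I that by (auto simp: lists_instance_def distinct_map intro: inj_on_subset)
    then show "matching (ends ` M) \<longleftrightarrow> disjoint_family_on ends M" "card (ends ` M) = card M"
      unfolding matching_def disjoint_def[symmetric]
      by (auto simp: disjoint_family_on_iff_disjoint_image card_image)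
    show "sum (weight I) (ends ` M) = sum wt M" by (rule sum_weight_ends[OF I that])
  qed
  have edges: "edges I = ends ` set es" using I by (simp add: lists_instance_def)
  have "(\<exists>M\<subseteq>edges I. matching M \<and> card M \<le> k \<and> t \<le> sum (weight I) M) \<longleftrightarrow>
      (\<exists>M\<subseteq>set es. matching (ends ` M) \<and> card (ends ` M) \<le> k \<and> t \<le> sum (weight I) (ends ` M))"
    unfolding edges subset_image_iff by blast
  also have "\<dots> \<longleftrightarrow> (\<exists>M\<subseteq>set es. disjoint_family_on ends M \<and> card M \<le> k \<and> t \<le> sum wt M)"
    using image by metis
  finally show ?thesis .
qed

lemma mepvcb_yes_iff_searches:
  assumes I: "mepvcb_instance I" "k3 I \<le> k1 I" and lists: "lists_instance I vs es"
    and N: "2 * k1 I \<le> N" "4 * (k1 I)\<^sup>2 < N"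
  shows "mepvcb_yes I \<longleftrightarrow>
    search N (k1 I) N (vertex_items vs) es (k2 I) \<and> search N (k1 I) N es [] (k3 I)"
proof -
  obtain A B where AB: "A \<inter> B = {}" "\<forall>e\<in>edges I. \<exists>a\<in>A. \<exists>b\<in>B. e = {a, b}"
    using I(1) by (auto simp: mepvcb_instance_def bipartite_def)
  have bip: "(a \<in> A) \<noteq> (b \<in> A)" if "(a, b, c) \<in> set es" for a b c
  proof -
    have "ends (a, b, c) \<in> edges I" using lists that unfolding lists_instance_def by blast
    then obtain x y where "x \<in> A" "y \<in> B" "{a, b} = {x, y}" using AB(2) by auto
    then show ?thesis using AB(1) by (auto simp: doubleton_eq_iff)
  qed
  have es: "distinct vs" "set vs = verts I" "distinct es" "inj_on ends (set es)"
    using lists by (simp_all add: lists_instance_def distinct_map)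
  show ?thesis
    using mepvcb_yes_iff[OF I] exists_matching_iff[OF lists] covered_weight_eq_coverage[OF lists]
      search_vertex_items_iff[OF es(1) N(1), of es "\<lambda>v. v \<in> A"] search_edges_iff[OF es(3,4) N(2)]
      bip es(2)
    by simp
qed

section \<open>Evaluation with time bounds\<close>

definition call :: "program \<Rightarrow> nat \<Rightarrow> val \<Rightarrow> val \<Rightarrow> nat \<Rightarrow> bool" where
  "call p f u v t \<longleftrightarrow> f < length p \<and> eval p [u] (p ! f) v t"

definition call_time :: "program \<Rightarrow> nat \<Rightarrow> val \<Rightarrow> nat" where
  "call_time p f u = (THE t. \<exists>v. call p f u v t)"

definition call_within :: "program \<Rightarrow> nat \<Rightarrow> val \<Rightarrow> val \<Rightarrow> nat \<Rightarrow> bool" where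
  "call_within p f u v T \<longleftrightarrow> (\<exists>t\<le>T. call p f u v t)"

lemma eval_EVar_iff: "eval p \<rho> (EVar i) v t \<longleftrightarrow> i < length \<rho> \<and> v = \<rho> ! i \<and> t = 1"
  by (auto elim: eval.cases intro: eval.intros[simplified])

lemma eval_EConst_iff: "eval p \<rho> (EConst n) v t \<longleftrightarrow> v = Num n \<and> t = 1"
  by (auto elim: eval.cases intro: eval.intros[simplified])

lemma eval_EAdd_iff: "eval p \<rho> (EAdd a b) v t \<longleftrightarrow>
    (\<exists>m s. eval p \<rho> a (Num m) s \<and> (\<exists>n r. eval p \<rho> b (Num n) r \<and>
      v = Num (m + n) \<and> t = s + r + floorlog 2 m + floorlog 2 n + 1))"
  by (rule iffI, erule eval.cases) (auto intro: eval.intros[simplified])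

lemma eval_ESub_iff: "eval p \<rho> (ESub a b) v t \<longleftrightarrow>
    (\<exists>m s. eval p \<rho> a (Num m) s \<and> (\<exists>n r. eval p \<rho> b (Num n) r \<and>
      v = Num (m - n) \<and> t = s + r + floorlog 2 m + floorlog 2 n + 1))"
  by (rule iffI, erule eval.cases) (auto intro: eval.intros[simplified])

lemma eval_ENode_iff: "eval p \<rho> (ENode a b) v t \<longleftrightarrow>
    (\<exists>x s. eval p \<rho> a x s \<and> (\<exists>y r. eval p \<rho> b y r \<and> v = Node x y \<and> t = s + r + 1))"
  by (rule iffI, erule eval.cases) (auto intro: eval.intros[simplified])

lemma eval_EFst_iff: "eval p \<rho> (EFst a) v t \<longleftrightarrow> (\<exists>y s. eval p \<rho> a (Node v y) s \<and> t = s + 1)"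
  by (rule iffI, erule eval.cases) (auto intro: eval.Fst[simplified])

lemma eval_ESnd_iff: "eval p \<rho> (ESnd a) v t \<longleftrightarrow> (\<exists>y s. eval p \<rho> a (Node y v) s \<and> t = s + 1)"
  by (rule iffI, erule eval.cases) (auto intro: eval.Snd[simplified])

lemma eval_EIf_iff: "eval p \<rho> (EIf c a b) v t \<longleftrightarrow>
    (\<exists>u s. eval p \<rho> c u s \<and>
      (\<exists>r. (if u = Num 0 then eval p \<rho> b v r else eval p \<rho> a v r) \<and> t = s + r + 1))"
  by (rule iffI, erule eval.cases)
    (auto intro: eval.If_nonzero[simplified] eval.If_zero[simplified] split: if_splits)

lemma eval_ELet_iff: "eval p \<rho> (ELet a b) v t \<longleftrightarrow>
    (\<exists>u s. eval p \<rho> a u s \<and> (\<exists>r. eval p (u # \<rho>) b v r \<and> t = s + r + 1))"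
  by (rule iffI, erule eval.cases) (auto intro: eval.Let[simplified])

lemma eval_ECall_iff: "eval p \<rho> (ECall f a) v t \<longleftrightarrow>
    (\<exists>u s. eval p \<rho> a u s \<and> (\<exists>r. call p f u v r \<and> t = s + r + 1))"
  unfolding call_def by (rule iffI, erule eval.cases) (auto intro: eval.Call[simplified])

lemmas eval_iffs = eval_EVar_iff eval_EConst_iff eval_EAdd_iff eval_ESub_iff eval_ENode_iff
  eval_EFst_iff eval_ESnd_iff eval_EIf_iff eval_ELet_iff eval_ECall_iff

lemma call_determ: "call p f u v t \<Longrightarrow> call p f u v' t' \<longleftrightarrow> v' = v \<and> t' = t"
  unfolding call_def using eval_deterministic by blast

lemma call_within_call_time:
  assumes "call_within p f u v T"
  shows "call p f u v (call_time p f u)" "call_time p f u \<le> T"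
proof -
  obtain t where t: "t \<le> T" "call p f u v t" using assms by (auto simp: call_within_def)
  have "call_time p f u = t"
    unfolding call_time_def using t(2) call_determ[OF t(2)] by (intro the_equality) auto
  then show "call p f u v (call_time p f u)" "call_time p f u \<le> T" using t by simp_all
qed

lemma call_iff:
  "call_within p f u v T \<Longrightarrow> call p f u v' t \<longleftrightarrow> v' = v \<and> t = call_time p f u"
  by (rule call_determ[OF call_within_call_time(1)])

lemmas call_time_le = call_within_call_time(2)

lemma call_withinI:
  "f < length p \<Longrightarrow> \<exists>t\<le>T. eval p [u] (p ! f) v t \<Longrightarrow> call_within p f u v T"
  by (simp add: call_within_def call_def)

lemma call_within_mono: "call_within p f u v T \<Longrightarrow> T \<le> T' \<Longrightarrow> call_within p f u v T'"
  unfolding call_within_def using le_trans by blast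

section \<open>The program\<close>

definition EAnd :: "expr \<Rightarrow> expr \<Rightarrow> expr" where
  "EAnd a b = EIf a b (EConst 0)"

definition EOr :: "expr \<Rightarrow> expr \<Rightarrow> expr" where
  "EOr a b = EIf a (EConst 1) b"

fun EList :: "expr list \<Rightarrow> expr" where
  "EList [] = EConst 0"
| "EList (e # es) = ENode e (EList es)"

fun ENth :: "nat \<Rightarrow> expr \<Rightarrow> expr" where
  "ENth 0 e = EFst e"
| "ENth (Suc n) e = ENth n (ESnd e)"

lemma ENth_numeral:
  "ENth 1 e = EFst (ESnd e)"
  "ENth (numeral n) e = ENth (pred_numeral n) (ESnd e)"
  by (simp_all add: numeral_eq_Suc)

abbreviation (input) "pow2_fn \<equiv> 1 :: nat"
abbreviation (input) "neq_fn \<equiv> 2 :: nat"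
abbreviation (input) "disjoint_fn \<equiv> 3 :: nat"
abbreviation (input) "avoiding_fn \<equiv> 4 :: nat"
abbreviation (input) "gain_fn \<equiv> 5 :: nat"
abbreviation (input) "heaviest_first_fn \<equiv> 6 :: nat"
abbreviation (input) "vertex_items_fn \<equiv> 7 :: nat"
abbreviation (input) "search_fn \<equiv> 8 :: nat"

definition pow2_body :: expr where
  "pow2_body = EIf (EVar 0)
     (ELet (ECall pow2_fn (ESub (EVar 0) (EConst 1))) (EAdd (EVar 0) (EVar 0)))
     (EConst 1)"

definition neq_body :: expr where
  "neq_body = EIf
     (EAdd (ESub (EFst (EVar 0)) (ESnd (EVar 0))) (ESub (ESnd (EVar 0)) (EFst (EVar 0))))
     (EConst 1) (EConst 0)"

definition disjoint_body :: expr where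
  "disjoint_body =
     EAnd (ECall neq_fn (ENode (ENth 0 (EFst (EVar 0))) (ENth 0 (ESnd (EVar 0)))))
     (EAnd (ECall neq_fn (ENode (ENth 0 (EFst (EVar 0))) (ENth 1 (ESnd (EVar 0)))))
     (EAnd (ECall neq_fn (ENode (ENth 1 (EFst (EVar 0))) (ENth 0 (ESnd (EVar 0)))))
       (ECall neq_fn (ENode (ENth 1 (EFst (EVar 0))) (ENth 1 (ESnd (EVar 0)))))))"

definition avoiding_body :: expr where
  "avoiding_body = EIf (ESnd (EVar 0))
     (ELet (ECall avoiding_fn (ENode (EFst (EVar 0)) (ESnd (ESnd (EVar 0)))))
       (EIf (ECall disjoint_fn (ENode (EFst (EVar 1)) (EFst (ESnd (EVar 1)))))
         (ENode (EFst (ESnd (EVar 1))) (EVar 0))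
         (EVar 0)))
     (EConst 0)"

definition gain_body :: expr where
  "gain_body = EIf (ESnd (EVar 0))
     (ELet (ECall gain_fn (ENode (EFst (EVar 0)) (ESnd (ESnd (EVar 0)))))
       (EIf (ECall disjoint_fn (ENode (EFst (EVar 1)) (EFst (ESnd (EVar 1)))))
         (EVar 0)
         (EAdd (ENth 2 (EFst (ESnd (EVar 1)))) (EVar 0))))
     (ENth 2 (EFst (EVar 0)))"

definition heaviest_first_body :: expr where
  "heaviest_first_body = EIf (ESnd (EVar 0))
     (ELet (ECall heaviest_first_fn (ENode (EFst (EVar 0)) (ESnd (ESnd (EVar 0)))))
       (EIf (EVar 0)
         (EIf (ESub (ECall gain_fn (ENode (EFst (EVar 0)) (EFst (EVar 1))))
                (ECall gain_fn (ENode (EFst (ESnd (EVar 1))) (EFst (EVar 1)))))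
           (ENode (EFst (EVar 0)) (ENode (EFst (ESnd (EVar 1))) (ESnd (EVar 0))))
           (ENode (EFst (ESnd (EVar 1))) (EVar 0)))
         (EList [EFst (ESnd (EVar 1))])))
     (EConst 0)"

definition vertex_items_body :: expr where
  "vertex_items_body = EIf (EVar 0)
     (ENode (EList [EFst (EVar 0), EFst (EVar 0), EConst 0])
       (ECall vertex_items_fn (ESnd (EVar 0))))
     (EConst 0)"

text \<open>The argument of the search is the list of the items, the edges, \<open>k\<close>, \<open>d\<close>, \<open>N\<close> and \<open>t\<close>.\<close>

definition search_body :: expr where
  "search_body = EIf (ENth 5 (EVar 0))
     (EAnd (ENth 2 (EVar 0)) (EAnd (ENth 3 (EVar 0))
       (ELet (ECall heaviest_first_fn (ENode (ENth 1 (EVar 0)) (ENth 0 (EVar 0))))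
         (EAnd (EVar 0)
           (EOr
             (ECall search_fn (EList
               [ECall avoiding_fn (ENode (EFst (EVar 0)) (ESnd (EVar 0))),
                ECall avoiding_fn (ENode (EFst (EVar 0)) (ENth 1 (EVar 1))),
                ESub (ENth 2 (EVar 1)) (EConst 1), ENth 4 (EVar 1), ENth 4 (EVar 1),
                ESub (ENth 5 (EVar 1))
                  (ECall gain_fn (ENode (EFst (EVar 0)) (ENth 1 (EVar 1))))]))
             (ECall search_fn (EList
               [ESnd (EVar 0), ENth 1 (EVar 1), ENth 2 (EVar 1),
                ESub (ENth 3 (EVar 1)) (EConst 1), ENth 4 (EVar 1), ENth 5 (EVar 1)])))))))
     (EConst 1)"

text \<open>The argument is an encoded instance, that is, the list of \<open>V\<close>, \<open>E\<close>, \<open>k\<^sub>1\<close>, \<open>k\<^sub>2\<close> and \<open>k\<^sub>3\<close>.\<close>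

definition main_body :: expr where
  "main_body =
     ELet (ECall pow2_fn (EAdd (EAdd (ENth 2 (EVar 0)) (ENth 2 (EVar 0))) (EConst 2)))
       (EAnd
         (ECall search_fn (EList
           [ECall vertex_items_fn (ENth 0 (EVar 1)), ENth 1 (EVar 1), ENth 2 (EVar 1),
            EVar 0, EVar 0, ENth 3 (EVar 1)]))
         (ECall search_fn (EList
           [ENth 1 (EVar 1), EConst 0, ENth 2 (EVar 1), EVar 0, EVar 0, ENth 4 (EVar 1)])))"

definition prog :: program where
  "prog = [main_body, pow2_body, neq_body, disjoint_body, avoiding_body, gain_body,
     heaviest_first_body, vertex_items_body, search_body]"

lemma prog_nth:
  "prog ! 0 = main_body" "prog ! Suc 0 = pow2_body" "prog ! neq_fn = neq_body"
  "prog ! disjoint_fn = disjoint_body" "prog ! avoiding_fn = avoiding_body"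
  "prog ! gain_fn = gain_body" "prog ! heaviest_first_fn = heaviest_first_body"
  "prog ! vertex_items_fn = vertex_items_body" "prog ! search_fn = search_body"
  by (simp_all add: prog_def)

lemma length_prog: "length prog = 9"
  by (simp add: prog_def)

lemmas prog_simps = prog_nth length_prog eval_iffs ENth_numeral EAnd_def EOr_def

section \<open>The running time of the subroutines\<close>

fun enc_item :: "nat item \<Rightarrow> val" where
  "enc_item (a, b, c) = val_list [Num a, Num b, Num c]"

abbreviation enc_items :: "nat item list \<Rightarrow> val" where
  "enc_items ts \<equiv> val_list (map enc_item ts)"

definition unit_time :: "nat \<Rightarrow> nat" where
  "unit_time W = 100 * (floorlog 2 W + 1)"

lemma call_within_pow2:
  assumes "length p > 1" "p ! 1 = pow2_body" "2 ^ n \<le> W"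
  shows "call_within p pow2_fn (Num n) (Num (2 ^ n)) ((n + 1) * unit_time W)"
  using assms(3)
proof (induction n)
  case 0
  show ?case using assms(1,2)
    by (intro call_withinI) (simp_all add: pow2_body_def eval_iffs unit_time_def)
next
  case (Suc n)
  have IH: "call_within p (Suc 0) (Num n) (Num (2 ^ n)) ((n + 1) * unit_time W)"
    using Suc by simp
  have "Suc n < 2 ^ Suc n" by (rule less_exp)
  then have "floorlog 2 (Suc n) \<le> floorlog 2 W" "floorlog 2 (2 ^ n) \<le> floorlog 2 W"
    "floorlog 2 (Suc 0) \<le> floorlog 2 W"
    using Suc.prems by (auto intro!: floorlog_mono)
  then show ?case using assms(1,2) call_time_le[OF IH]
    by (intro call_withinI)
      (simp_all add: pow2_body_def eval_iffs unit_time_def call_iff[OF IH])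
qed

lemma call_within_neq:
  assumes "x \<le> W" "y \<le> W"
  shows "call_within prog neq_fn (Node (Num x) (Num y)) (Num (if x = y then 0 else 1))
    (unit_time W)"
proof -
  have "floorlog 2 x \<le> floorlog 2 W" "floorlog 2 y \<le> floorlog 2 W"
    "floorlog 2 (x - y) \<le> floorlog 2 W" "floorlog 2 (y - x) \<le> floorlog 2 W"
    using assms by (auto intro!: floorlog_mono)
  then show ?thesis
    by (intro call_withinI; cases "x = y")
      (auto simp: prog_simps neq_body_def unit_time_def)
qed

lemma call_within_disjoint:
  assumes "ends e \<subseteq> {..W}" "ends f \<subseteq> {..W}"
  shows "call_within prog disjoint_fn (Node (enc_item e) (enc_item f))
    (Num (if ends f \<inter> ends e = {} then 1 else 0)) (5 * unit_time W)"
proof -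
  obtain a b c where e: "e = (a, b, c)" by (cases e)
  obtain a' b' c' where f: "f = (a', b', c')" by (cases f)
  define neq :: "nat \<Rightarrow> nat \<Rightarrow> nat" where "neq x y = (if x = y then 0 else 1)" for x y
  have "call_within prog neq_fn (Node (Num x) (Num y)) (Num (neq x y)) (unit_time W)"
    if "x \<in> ends e" "y \<in> ends f" for x y
    using assms that unfolding neq_def by (intro call_within_neq) auto
  then have calls: "call_within prog neq_fn (Node (Num a) (Num a')) (Num (neq a a')) (unit_time W)"
    "call_within prog neq_fn (Node (Num a) (Num b')) (Num (neq a b')) (unit_time W)"
    "call_within prog neq_fn (Node (Num b) (Num a')) (Num (neq b a')) (unit_time W)"
    "call_within prog neq_fn (Node (Num b) (Num b')) (Num (neq b b')) (unit_time W)"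
    by (simp_all add: e f)
  have result: "(if ends f \<inter> ends e = {} then 1 else 0) =
      (if neq a a' = 0 \<or> neq a b' = 0 \<or> neq b a' = 0 then 0 else neq b b')"
    by (auto simp: neq_def e f)
  show ?thesis
    unfolding result using calls[THEN call_time_le]
    by (intro call_withinI; cases "neq a a' = 0"; cases "neq a b' = 0"; cases "neq b a' = 0")
      (simp_all add: e f prog_simps disjoint_body_def unit_time_def calls[THEN call_iff])
qed

lemma call_within_avoiding:
  assumes "ends e \<subseteq> {..W}" "\<And>f. f \<in> set es \<Longrightarrow> ends f \<subseteq> {..W}"
  shows "call_within prog avoiding_fn (Node (enc_item e) (enc_items es))
    (enc_items (avoiding (ends e) es)) (6 * ((length es + 1) * unit_time W))"
  using assms(2)
proof (induction es)
  case Nil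
  show ?case
    by (intro call_withinI) (simp_all add: prog_simps avoiding_body_def avoiding_def unit_time_def)
next
  case (Cons f es)
  have IH: "call_within prog avoiding_fn (Node (enc_item e) (enc_items es))
      (enc_items (avoiding (ends e) es)) (6 * ((length es + 1) * unit_time W))"
    by (rule Cons.IH) (use Cons.prems in simp)
  have disjoint: "call_within prog disjoint_fn (Node (enc_item e) (enc_item f))
      (Num (if ends f \<inter> ends e = {} then 1 else 0)) (5 * unit_time W)"
    using assms(1) Cons.prems by (intro call_within_disjoint) simp_all
  show ?case
    using call_time_le[OF IH] call_time_le[OF disjoint]
    by (intro call_withinI; cases "ends f \<inter> ends e = {}")
      (simp_all add: prog_simps avoiding_body_def call_iff[OF IH] call_iff[OF disjoint]
        unit_time_def avoiding_def)
qed

definition total_weight :: "nat item list \<Rightarrow> nat" where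
  "total_weight es = (\<Sum>e\<leftarrow>es. wt e)"

lemma gain_singleton_le: "gain {e} es \<le> wt e + total_weight es"
  by (induction es) (auto simp: gain_singleton coverage_Cons total_weight_def)

lemma gain_singleton_Cons:
  "gain {e} (f # es) = (if ends f \<inter> ends e = {} then 0 else wt f) + gain {e} es"
  by (simp add: gain_singleton coverage_Cons)

lemma call_within_gain:
  assumes "ends e \<subseteq> {..W}" "\<And>f. f \<in> set es \<Longrightarrow> ends f \<subseteq> {..W}" "wt e + total_weight es \<le> W"
  shows "call_within prog gain_fn (Node (enc_item e) (enc_items es)) (Num (gain {e} es))
    (6 * ((length es + 1) * unit_time W))"
  using assms(2,3)
proof (induction es)
  case Nil
  obtain a b c where "e = (a, b, c)" by (cases e)
  then show ?case
    by (intro call_withinI) (simp_all add: prog_simps gain_body_def unit_time_def)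
next
  case (Cons f es)
  obtain a b c where f: "f = (a, b, c)" by (cases f)
  have sum: "wt e + total_weight es + c \<le> W" using Cons.prems(2) by (simp add: total_weight_def f)
  have IH: "call_within prog gain_fn (Node (enc_item e) (enc_items es)) (Num (gain {e} es))
      (6 * ((length es + 1) * unit_time W))"
    by (rule Cons.IH) (use Cons.prems(1) sum in simp_all)
  have disjoint: "call_within prog disjoint_fn (Node (enc_item e) (enc_item f))
      (Num (if ends f \<inter> ends e = {} then 1 else 0)) (5 * unit_time W)"
    using assms(1) Cons.prems by (intro call_within_disjoint) simp_all
  have "floorlog 2 c \<le> floorlog 2 W" "floorlog 2 (gain {e} es) \<le> floorlog 2 W"
    using sum gain_singleton_le[of e es] by (auto intro!: floorlog_mono)
  then show ?case
    using call_time_le[OF IH] call_time_le[OF disjoint]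
    by (intro call_withinI; cases "a \<in> ends e"; cases "b \<in> ends e")
      (simp_all add: prog_simps gain_body_def call_iff[OF IH] unit_time_def gain_singleton_Cons f
        call_iff[OF disjoint[unfolded f, simplified]])
qed

definition state_bounded :: "nat \<Rightarrow> nat \<Rightarrow> nat item list \<Rightarrow> nat item list \<Rightarrow> bool" where
  "state_bounded W L ts es \<longleftrightarrow> length ts \<le> L \<and> length es \<le> L \<and>
    (\<forall>e\<in>set ts \<union> set es. ends e \<subseteq> {..W}) \<and> (\<forall>e\<in>set ts. wt e + total_weight es \<le> W)"

lemma total_weight_avoiding_le: "total_weight (avoiding S es) \<le> total_weight es"
  by (induction es) (auto simp: total_weight_def avoiding_def)

lemma length_avoiding_le: "length (avoiding S es) \<le> length es"
  by (simp add: avoiding_def)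

lemma state_bounded_avoiding:
  assumes "state_bounded W L ts es"
  shows "state_bounded W L (avoiding S ts) (avoiding S es)"
  unfolding state_bounded_def
proof (intro conjI ballI)
  show "length (avoiding S ts) \<le> L" "length (avoiding S es) \<le> L"
    using assms length_avoiding_le le_trans unfolding state_bounded_def by blast+
  show "ends e \<subseteq> {..W}" if "e \<in> set (avoiding S ts) \<union> set (avoiding S es)" for e
    using assms that unfolding state_bounded_def set_avoiding by blast
  show "wt e + total_weight (avoiding S es) \<le> W" if "e \<in> set (avoiding S ts)" for e
  proof -
    have "wt e + total_weight es \<le> W"
      using assms that unfolding state_bounded_def set_avoiding by blast
    then show ?thesis using total_weight_avoiding_le[of S es] by linarith
  qed
qed

lemma state_bounded_tail:
  "heaviest_first es ts = m # r \<Longrightarrow> state_bounded W L ts es \<Longrightarrow> state_bounded W L r es"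
  using heaviest_first_eq_ConsD[of es ts m r] by (auto simp: state_bounded_def)

lemma call_within_gain_of_candidate:
  assumes "state_bounded W L ts es" "e \<in> set ts"
  shows "call_within prog gain_fn (Node (enc_item e) (enc_items es)) (Num (gain {e} es))
      (6 * ((length es + 1) * unit_time W))"
    and "gain {e} es \<le> W"
proof -
  have weight: "wt e + total_weight es \<le> W" using assms unfolding state_bounded_def by blast
  then show "gain {e} es \<le> W" using gain_singleton_le[of e es] by simp
  show "call_within prog gain_fn (Node (enc_item e) (enc_items es)) (Num (gain {e} es))
      (6 * ((length es + 1) * unit_time W))"
    using assms weight unfolding state_bounded_def by (intro call_within_gain) blast+
qed

lemma call_within_heaviest_first:
  assumes "state_bounded W L ts es"
  shows "call_within prog heaviest_first_fn (Node (enc_items es) (enc_items ts))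
    (enc_items (heaviest_first es ts)) ((length ts + 1) * (13 * ((length es + 1) * unit_time W)))"
  using assms
proof (induction ts)
  case Nil
  show ?case
    by (intro call_withinI) (simp_all add: prog_simps heaviest_first_body_def unit_time_def)
next
  case (Cons e ts)
  define C where "C = (length es + 1) * unit_time W"
  have overhead: "100 * (floorlog 2 W + 1) \<le> C" by (simp add: C_def unit_time_def)
  have IH: "call_within prog heaviest_first_fn (Node (enc_items es) (enc_items ts))
      (enc_items (heaviest_first es ts)) ((length ts + 1) * (13 * C))"
    unfolding C_def by (rule Cons.IH) (use Cons.prems in \<open>auto simp: state_bounded_def\<close>)
  note gain = call_within_gain_of_candidate[OF Cons.prems, folded C_def]
  have "call_within prog heaviest_first_fn (Node (enc_items es) (enc_items (e # ts)))
      (enc_items (heaviest_first es (e # ts))) ((length (e # ts) + 1) * (13 * C))"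
  proof (cases "heaviest_first es ts")
    case Nil
    then have "ts = []" by simp
    note rec = IH[unfolded this, simplified]
    show ?thesis using call_time_le[OF rec] overhead
      unfolding \<open>ts = []\<close> by (intro call_withinI)
        (simp_all add: prog_simps heaviest_first_body_def call_iff[OF rec])
  next
    case (Cons m r)
    have "m \<in> set (e # ts)" "e \<in> set (e # ts)"
      using heaviest_first_eq_ConsD(1)[OF Cons] by simp_all
    note calls = this[THEN gain(1)] and logs = this[THEN gain(2), THEN floorlog_mono, of 2]
    show ?thesis
      using call_time_le[OF IH] calls[THEN call_time_le] logs overhead Cons
      by (intro call_withinI; cases "gain {e} es < gain {m} es")
        (simp_all add: prog_simps heaviest_first_body_def call_iff[OF IH] calls[THEN call_iff])
  qed
  then show ?case unfolding C_def .
qed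

lemma call_within_vertex_items:
  "call_within prog vertex_items_fn (val_list (map Num vs)) (enc_items (vertex_items vs))
    ((length vs + 1) * unit_time W)"
proof (induction vs)
  case Nil
  show ?case
    by (intro call_withinI) (simp_all add: prog_simps vertex_items_body_def unit_time_def)
next
  case (Cons v vs)
  then show ?case using call_time_le[OF Cons.IH]
    by (intro call_withinI)
      (simp_all add: prog_simps vertex_items_body_def call_iff[OF Cons.IH] unit_time_def)
qed

section \<open>The running time of the search\<close>

definition step_time :: "nat \<Rightarrow> nat \<Rightarrow> nat" where
  "step_time L W = 40 * (L + 1)\<^sup>2 * unit_time W"

text \<open>Both recursive calls lower \<open>k (N + 1) + d\<close>, so the recursion tree has at most that depth.\<close>

definition search_time :: "nat \<Rightarrow> nat \<Rightarrow> nat \<Rightarrow> nat \<Rightarrow> nat \<Rightarrow> nat" where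
  "search_time L W N k d = step_time L W * (2 ^ (k * (N + 1) + d + 1) - 1)"

lemma step_time_le_search_time: "step_time L W \<le> search_time L W N k d"
proof -
  have "1 \<le> 2 ^ (k * (N + 1) + d + 1) - (1 :: nat)"
    using less_exp[of "k * (N + 1) + d + 1"] by linarith
  then have "step_time L W * 1 \<le> search_time L W N k d"
    unfolding search_time_def by (rule mult_left_mono) simp
  then show ?thesis by simp
qed

lemma search_time_recurrence:
  "step_time L W + search_time L W N k N + search_time L W N (Suc k) d
    \<le> search_time L W N (Suc k) (Suc d)"
proof -
  let ?n = "Suc k * (N + 1) + d + 1" and ?m = "k * (N + 1) + N + 1"
  have "(2 :: nat) ^ ?m \<le> 2 ^ ?n" by (intro power_increasing) auto
  moreover have "1 \<le> (2 :: nat) ^ ?m" by simp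
  ultimately have "1 + (2 ^ ?m - 1) + (2 ^ ?n - 1) \<le> 2 * 2 ^ ?n - (1 :: nat)" by linarith
  then have "step_time L W * (1 + (2 ^ ?m - 1) + (2 ^ ?n - 1)) \<le> step_time L W * (2 * 2 ^ ?n - 1)"
    by (rule mult_left_mono) simp
  moreover have "Suc k * (N + 1) + Suc d + 1 = Suc ?n" by simp
  ultimately show ?thesis
    unfolding search_time_def by (simp only: distrib_left mult_1_right power_Suc)
qed

abbreviation enc_state :: "nat item list \<Rightarrow> nat item list \<Rightarrow> nat \<Rightarrow> nat \<Rightarrow> nat \<Rightarrow> nat \<Rightarrow> val" where
  "enc_state ts es k d N t \<equiv> Node (enc_items ts) (Node (enc_items es)
    (Node (Num k) (Node (Num d) (Node (Num N) (Node (Num t) (Num 0))))))"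

abbreviation enc_bool :: "bool \<Rightarrow> val" where
  "enc_bool b \<equiv> Num (if b then 1 else 0)"

lemma call_within_search_leaf:
  assumes "state_bounded W L ts es" "t = 0 \<or> k = 0 \<or> d = 0 \<or> ts = []"
  shows "call_within prog search_fn (enc_state ts es k d N t) (enc_bool (search N k d ts es t))
    (search_time L W N k d)"
proof -
  have result: "search N k d ts es t \<longleftrightarrow> t = 0"
    using assms(2) by (cases k; cases d) auto
  have empty: "call_within prog heaviest_first_fn (Node (enc_items es) (Num 0)) (Num 0)
      (13 * ((length es + 1) * unit_time W))"
    using call_within_heaviest_first[of W L "[]" es] assms(1) by (simp add: state_bounded_def)
  have "13 * ((length es + 1) * unit_time W) \<le> 13 * ((L + 1)\<^sup>2 * unit_time W)"
    using assms(1) by (intro mult_left_mono mult_right_mono)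
      (auto simp: state_bounded_def power2_eq_square)
  then have "call_time prog heaviest_first_fn (Node (enc_items es) (Num 0))
       \<le> 13 * ((L + 1)\<^sup>2 * unit_time W)"
    using call_time_le[OF empty] by linarith
  moreover have "unit_time W \<le> (L + 1)\<^sup>2 * unit_time W" by simp
  ultimately have "call_time prog heaviest_first_fn (Node (enc_items es) (Num 0)) + unit_time W
      \<le> step_time L W"
    unfolding step_time_def by linarith
  also have "\<dots> \<le> search_time L W N k d" by (rule step_time_le_search_time)
  finally show ?thesis
    unfolding result using assms(2)
    by (intro call_withinI; cases "t = 0"; cases "k = 0"; cases "d = 0")
      (simp_all add: prog_simps search_body_def call_iff[OF empty] unit_time_def)
qed

lemma call_within_search_steps:
  assumes bounded: "state_bounded W L ts es" and first: "heaviest_first es ts = m # r"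
    and C: "C = (L + 1)\<^sup>2 * unit_time W"
  shows "call_within prog heaviest_first_fn (Node (enc_items es) (enc_items ts))
      (Node (enc_item m) (enc_items r)) (13 * C)"
    and "call_within prog avoiding_fn (Node (enc_item m) (enc_items r))
      (enc_items (avoiding (ends m) r)) (6 * C)"
    and "call_within prog avoiding_fn (Node (enc_item m) (enc_items es))
      (enc_items (avoiding (ends m) es)) (6 * C)"
    and "call_within prog gain_fn (Node (enc_item m) (enc_items es)) (Num (gain {m} es)) (6 * C)"
proof -
  note ts_eq = heaviest_first_eq_ConsD(1,2)[OF first]
  have lengths: "length r \<le> L" "length es \<le> L" "length ts \<le> L" and ends: "ends m \<subseteq> {..W}"
    "\<And>f. f \<in> set r \<Longrightarrow> ends f \<subseteq> {..W}" "\<And>f. f \<in> set es \<Longrightarrow> ends f \<subseteq> {..W}"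
    using bounded ts_eq unfolding state_bounded_def by auto
  have linear: "6 * ((n + 1) * unit_time W) \<le> 6 * C" if "n \<le> L" for n
    using that unfolding C
    by (intro mult_left_mono mult_right_mono) (auto simp: power2_eq_square)
  have "(length ts + 1) * (13 * ((length es + 1) * unit_time W))
      \<le> (L + 1) * (13 * ((L + 1) * unit_time W))"
    using lengths by (intro mult_mono) auto
  also have "\<dots> = 13 * C" by (simp add: C power2_eq_square algebra_simps)
  finally show "call_within prog heaviest_first_fn (Node (enc_items es) (enc_items ts))
      (Node (enc_item m) (enc_items r)) (13 * C)"
    using call_within_heaviest_first[OF bounded] call_within_mono by (simp add: first)
  show "call_within prog avoiding_fn (Node (enc_item m) (enc_items r))
      (enc_items (avoiding (ends m) r)) (6 * C)"
    by (rule call_within_mono[OF call_within_avoiding[OF ends(1,2)] linear[OF lengths(1)]])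
  show "call_within prog avoiding_fn (Node (enc_item m) (enc_items es))
      (enc_items (avoiding (ends m) es)) (6 * C)"
    by (rule call_within_mono[OF call_within_avoiding[OF ends(1,3)] linear[OF lengths(2)]])
  show "call_within prog gain_fn (Node (enc_item m) (enc_items es)) (Num (gain {m} es)) (6 * C)"
    using call_within_gain_of_candidate(1)[OF bounded, of m] linear[OF lengths(2)]
    by (rule call_within_mono) (simp add: ts_eq)
qed

lemma call_within_search_branch:
  assumes bounded: "state_bounded W L ts es" "Suc k \<le> W" "Suc d \<le> W" "t \<le> W" and "0 < t"
    and first: "heaviest_first es ts = m # r"
    and take: "call_within prog search_fn
      (enc_state (avoiding (ends m) r) (avoiding (ends m) es) k N N (t - gain {m} es))
      (enc_bool taken) T\<^sub>1"
    and discard: "call_within prog search_fn (enc_state r es (Suc k) d N t)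
      (enc_bool discarded) T\<^sub>2"
  shows "call_within prog search_fn (enc_state ts es (Suc k) (Suc d) N t)
    (enc_bool (taken \<or> discarded)) (step_time L W + T\<^sub>1 + T\<^sub>2)"
proof -
  define C where "C = (L + 1)\<^sup>2 * unit_time W"
  note steps = call_within_search_steps[OF bounded(1) first C_def]
  have "gain {m} es \<le> W"
    by (rule call_within_gain_of_candidate(2)[OF bounded(1)])
      (simp add: heaviest_first_eq_ConsD(1)[OF first])
  then have "floorlog 2 n \<le> floorlog 2 W" if "n \<in> {Suc k, Suc d, t, gain {m} es, 1}" for n
    using that bounded by (auto intro!: floorlog_mono)
  note logs = this[of "Suc k"] this[of "Suc d"] this[of t] this[of "gain {m} es"] this[of 1]
  have "unit_time W \<le> C" "step_time L W = 40 * C" by (simp_all add: step_time_def C_def)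
  then have "31 * C + 9 * unit_time W \<le> step_time L W" by linarith
  then show ?thesis
    using steps[THEN call_time_le] call_time_le[OF take] call_time_le[OF discard] logs \<open>0 < t\<close>
    by (intro call_withinI; cases taken)
      (simp_all add: prog_simps search_body_def steps[THEN call_iff] call_iff[OF take, simplified]
        call_iff[OF discard, simplified] unit_time_def)
qed

lemma call_within_search:
  assumes "state_bounded W L ts es" "k \<le> W" "d \<le> W" "N \<le> W" "t \<le> W"
  shows "call_within prog search_fn (enc_state ts es k d N t) (enc_bool (search N k d ts es t))
    (search_time L W N k d)"
  using assms
proof (induction N k d ts es t rule: search.induct)
  case (1 N d ts es t)
  show ?case by (rule call_within_search_leaf[OF "1.prems"(1)]) simp
next
  case (2 N k ts es t)
  show ?case by (rule call_within_search_leaf[OF "2.prems"(1)]) simp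
next
  case (3 N k d ts es t)
  show ?case
  proof (cases "t = 0 \<or> ts = []")
    case True
    then show ?thesis by (intro call_within_search_leaf[OF "3.prems"(1)]) blast
  next
    case False
    then obtain m r where first: "heaviest_first es ts = m # r"
      by (metis heaviest_first_eq_Nil_iff neq_Nil_conv)
    let ?taken = "search N k N (avoiding (ends m) r) (avoiding (ends m) es) (t - gain {m} es)"
    let ?discarded = "search N (Suc k) d r es t"
    note tail = state_bounded_tail[OF first "3.prems"(1)]
    have take: "call_within prog search_fn
        (enc_state (avoiding (ends m) r) (avoiding (ends m) es) k N N (t - gain {m} es))
        (enc_bool ?taken) (search_time L W N k N)"
      using "3.prems" by (intro "3.IH"(1)[OF first] state_bounded_avoiding[OF tail]) auto
    have discard: "call_within prog search_fn (enc_state r es (Suc k) d N t)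
        (enc_bool ?discarded) (search_time L W N (Suc k) d)"
      using "3.prems" by (intro "3.IH"(2)[OF first] tail) auto
    have "search N (Suc k) (Suc d) ts es t \<longleftrightarrow> ?taken \<or> ?discarded"
      using False first by simp
    then show ?thesis
      using call_within_mono[OF call_within_search_branch[OF _ _ _ _ _ first take discard]
          search_time_recurrence] "3.prems" False by simp
  qed
qed

section \<open>The running time of the program\<close>

lemma main_overhead_le:
  assumes "N = 2 ^ (2 * k + 2)" "n \<le> L"
  shows "(2 * k + 3) * unit_time W + (n + 1) * unit_time W + 2 * unit_time W
    \<le> step_time L W * 2 ^ (k * (N + 1) + N + 1)"
proof -
  have "2 * k + 2 < N" unfolding assms(1) by (rule less_exp)
  moreover have "N < 2 ^ N" by (rule less_exp)
  moreover have "(2 :: nat) ^ N \<le> 2 ^ (k * (N + 1) + N + 1)" by (intro power_increasing) auto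
  ultimately have tree: "2 * k + 6 \<le> 40 * 2 ^ (k * (N + 1) + N + 1)" by linarith
  have "(2 * k + 5) * unit_time W \<le> (2 * k + 5) * ((L + 1)\<^sup>2 * unit_time W)" by simp
  moreover have "(n + 1) * unit_time W \<le> (L + 1)\<^sup>2 * unit_time W"
    using assms(2) by (intro mult_right_mono) (auto simp: power2_eq_square)
  ultimately have "(2 * k + 3) * unit_time W + (n + 1) * unit_time W + 2 * unit_time W
      \<le> (2 * k + 6) * ((L + 1)\<^sup>2 * unit_time W)"
    by (simp add: algebra_simps)
  also have "\<dots> \<le> 40 * 2 ^ (k * (N + 1) + N + 1) * ((L + 1)\<^sup>2 * unit_time W)"
    using tree by (rule mult_right_mono) simp
  also have "\<dots> = step_time L W * 2 ^ (k * (N + 1) + N + 1)" by (simp add: step_time_def mult_ac)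
  finally show ?thesis .
qed

lemma call_within_main:
  assumes bounded: "state_bounded W L (vertex_items vs) es" "state_bounded W L es []"
    "k \<le> W" "t \<le> W" "s \<le> W" "N \<le> W" and N: "N = 2 ^ (2 * k + 2)"
  shows "call_within prog 0 (val_list [val_list (map Num vs), enc_items es, Num k, Num t, Num s])
    (enc_bool (search N k N (vertex_items vs) es t \<and> search N k N es [] s))
    (3 * (step_time L W * 2 ^ (k * (N + 1) + N + 1)))"
proof -
  define T where "T = step_time L W * 2 ^ (k * (N + 1) + N + 1)"
  have "call_within prog pow2_fn (Num (2 * k + 2)) (Num N) ((2 * k + 2 + 1) * unit_time W)"
    unfolding N by (rule call_within_pow2) (use bounded(6) N in \<open>simp_all add: prog_def\<close>)
  then have pow2: "call_within prog (Suc 0) (Num (Suc (Suc (k + k)))) (Num N)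
      ((2 * k + 3) * unit_time W)"
    by (simp add: mult_2 numeral_3_eq_3)
  note items = call_within_vertex_items[of vs W]
  have search: "call_within prog search_fn (enc_state ts es' k N N t')
      (enc_bool (search N k N ts es' t')) T" if "state_bounded W L ts es'" "t' \<le> W" for ts es' t'
    by (rule call_within_mono[OF call_within_search[of W L]])
      (use that bounded in \<open>auto simp: T_def search_time_def\<close>)
  note covering = search[OF bounded(1,4)] and matching = search[OF bounded(2,5)]
  have "length vs \<le> L" using bounded(1) by (simp add: state_bounded_def)
  then have overhead: "call_time prog (Suc 0) (Num (Suc (Suc (k + k)))) +
      call_time prog vertex_items_fn (val_list (map Num vs)) + 200 * (floorlog 2 W + 1) \<le> T"
    using call_time_le[OF pow2] call_time_le[OF items] main_overhead_le[OF N, of "length vs" L W]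
    by (simp add: T_def unit_time_def)
  have "2 * k + 2 < N" unfolding N by (rule less_exp)
  then have "floorlog 2 k \<le> floorlog 2 W" "floorlog 2 (k + k) \<le> floorlog 2 W"
    "floorlog 2 2 \<le> floorlog 2 W"
    using bounded(6) by (auto intro!: floorlog_mono)
  then show ?thesis
    unfolding T_def[symmetric]
    using overhead call_time_le[OF covering] call_time_le[OF matching]
    by (intro call_withinI; cases "search N k N (vertex_items vs) es t")
      (simp_all add: prog_simps main_body_def call_iff[OF pow2] call_iff[OF items]
        call_iff[OF covering] call_iff[OF matching, simplified] del: map_map)
qed

lemma step_time_le:
  assumes "W = 2 ^ S + 2 ^ (2 * k + 2)"
  shows "step_time S W \<le> 20000 * (k + 1) * (S + 1) ^ 3"
proof -
  have "W \<le> 2 ^ (S + 2 * k + 2) + 2 ^ (S + 2 * k + 2)"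
    unfolding assms by (intro add_mono power_increasing) auto
  also have "\<dots> = 2 ^ (S + 2 * k + 3)" by (simp add: power_add)
  also have "\<dots> < 2 ^ (S + 2 * k + 4)" by (intro power_strict_increasing) auto
  finally have "floorlog 2 W \<le> S + 2 * k + 4" by (simp add: floorlog_le_iff)
  then have "unit_time W \<le> 500 * ((S + 1) * (k + 1))" by (simp add: unit_time_def algebra_simps)
  then have "step_time S W \<le> 40 * (S + 1)\<^sup>2 * (500 * ((S + 1) * (k + 1)))"
    unfolding step_time_def by (intro mult_left_mono) auto
  also have "\<dots> = 20000 * (k + 1) * (S + 1) ^ 3"
    by (simp add: power2_eq_square power3_eq_cube algebra_simps)
  finally show ?thesis .
qed

lemma tree_depth_le:
  fixes k :: nat
  assumes "N = 2 ^ (2 * k + 2)"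
  shows "16 + k + (k * (N + 1) + N + 1) \<le> 2 ^ (3 * k + 5)"
proof -
  have k: "k + 1 \<le> 2 ^ k" by (simp add: Suc_le_eq)
  have "(k + 1) * (N + 1) \<le> 2 ^ k * 2 ^ (2 * k + 3)"
    using k unfolding assms by (intro mult_le_mono) (simp_all add: power_add)
  also have "\<dots> = 2 ^ (3 * k + 3)" by (simp flip: power_add)
  finally have tree: "(k + 1) * (N + 1) \<le> 2 ^ (3 * k + 3)" .
  have "16 + k \<le> 16 * 2 ^ k" using k by linarith
  also have "\<dots> = 2 ^ (k + 4)" by (simp add: power_add)
  also have "\<dots> \<le> 2 ^ (3 * k + 4)" by (intro power_increasing) auto
  finally have factor: "16 + k \<le> 2 ^ (3 * k + 4)" .
  have "16 + k + (k * (N + 1) + N + 1) = 16 + k + (k + 1) * (N + 1)" by simp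
  also have "\<dots> \<le> 2 ^ (3 * k + 4) + 2 ^ (3 * k + 3)" using tree factor by linarith
  also have "\<dots> \<le> 2 ^ (3 * k + 5)" by (simp add: power_add)
  finally show ?thesis .
qed

lemma main_time_le:
  assumes W: "W = 2 ^ S + N" and N: "N = 2 ^ (2 * k + 2)"
  shows "3 * (step_time S W * 2 ^ (k * (N + 1) + N + 1)) \<le> 2 ^ (2 ^ (3 * k + 5)) * (S + 1) ^ 3"
proof -
  let ?E = "k * (N + 1) + N + 1"
  have "3 * (step_time S W * 2 ^ ?E) \<le> 3 * (20000 * (k + 1) * (S + 1) ^ 3 * 2 ^ ?E)"
    using step_time_le[of W S k] W N by (intro mult_le_mono) auto
  also have "\<dots> = 60000 * (k + 1) * 2 ^ ?E * (S + 1) ^ 3" by simp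
  also have "\<dots> \<le> 2 ^ 16 * 2 ^ k * 2 ^ ?E * (S + 1) ^ 3"
    by (intro mult_le_mono) (auto simp: Suc_le_eq)
  also have "\<dots> = 2 ^ (16 + k + ?E) * (S + 1) ^ 3" by (simp only: power_add)
  also have "\<dots> \<le> 2 ^ (2 ^ (3 * k + 5)) * (S + 1) ^ 3"
    using tree_depth_le[OF N] by (intro mult_right_mono power_increasing) auto
  finally show ?thesis .
qed

lemma computable_double_exp: "computable (\<lambda>n. 2 ^ (2 ^ (3 * n + 5)))"
proof -
  define p where
    "p = [ECall pow2_fn (ECall pow2_fn (EAdd (EAdd (EAdd (EVar 0) (EVar 0)) (EVar 0)) (EConst 5))),
      pow2_body]"
  have p: "p \<noteq> []" "p ! 0 =
      ECall pow2_fn (ECall pow2_fn (EAdd (EAdd (EAdd (EVar 0) (EVar 0)) (EVar 0)) (EConst 5)))"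
    by (simp_all add: p_def)
  have pow2: "call_within p (Suc 0) (Num m) (Num (2 ^ m)) ((m + 1) * unit_time (2 ^ m))" for m
    using call_within_pow2[of p m "2 ^ m"] by (simp add: p_def)
  have "\<exists>t. run p (Num n) (Num (2 ^ (2 ^ (3 * n + 5)))) t" for n
  proof -
    have "n + n + n + 5 = 3 * n + 5" by simp
    then show ?thesis
      unfolding run_def p using p(1) by (simp add: eval_iffs call_iff[OF pow2] del: power_Suc)
  qed
  then show ?thesis unfolding computable_def by blast
qed

lemma search_width_ge:
  fixes k :: nat
  shows "2 * k \<le> 2 ^ (2 * k + 2)" "4 * k\<^sup>2 < 2 ^ (2 * k + 2)"
proof -
  show "2 * k \<le> 2 ^ (2 * k + 2)" using less_exp[of "2 * k + 2"] by linarith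
  have "k\<^sup>2 < (2 ^ k)\<^sup>2" by (intro power_strict_mono less_exp) auto
  then show "4 * k\<^sup>2 < 2 ^ (2 * k + 2)" by (simp add: power_add power_mult power2_eq_square
        flip: power_mult_distrib)
qed

section \<open>Encoded instances\<close>

abbreviation enc_instance :: "mepvcb \<Rightarrow> nat list \<Rightarrow> nat item list \<Rightarrow> val" where
  "enc_instance I vs es \<equiv>
    val_list [val_list (map Num vs), enc_items es, Num (k1 I), Num (k2 I), Num (k3 I)]"

lemma mepvcb_encodes_iff:
  "mepvcb_encodes I x \<longleftrightarrow> (\<exists>vs es. lists_instance I vs es \<and> x = enc_instance I vs es)"
proof -
  have "(\<lambda>(u, v :: nat, c). {u, v}) = ends"
    "(\<lambda>(u, v, c). val_list [Num u, Num v, Num c]) = enc_item"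
    by (auto simp: fun_eq_iff)
  moreover have "(\<forall>(u, v, c)\<in>set es. c = weight I {u, v}) \<longleftrightarrow> (\<forall>e\<in>set es. wt e = weight I (ends e))"
    for es by (auto split: prod.splits)
  ultimately show ?thesis
    unfolding mepvcb_encodes_def lists_instance_def by auto
qed

lemma less_exp_val_size: "n < 2 ^ val_size (Num n)"
proof -
  have "n < 2 ^ floorlog 2 n" using floorlog_bounds[of n 2] by (cases "n = 0") auto
  also have "\<dots> \<le> 2 ^ val_size (Num n)" by (intro power_increasing) auto
  finally show ?thesis .
qed

lemma less_exp_if_val_size_le: "val_size (Num n) \<le> S \<Longrightarrow> n < 2 ^ S"
  using less_exp_val_size[of n] power_increasing[of "val_size (Num n)" S "2::nat"] by simp

lemma val_size_le_val_list: "x \<in> set xs \<Longrightarrow> val_size x \<le> val_size (val_list xs)"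
  by (induction xs) auto

lemma length_le_val_list: "length xs \<le> val_size (val_list xs)"
  by (induction xs) auto

lemma total_weight_less: "total_weight es < 2 ^ val_size (enc_items es)"
proof (induction es)
  case (Cons e es)
  obtain a b c where e: "e = (a, b, c)" by (cases e)
  let ?p = "val_size (Num c)" and ?q = "val_size (enc_items es)"
  have "c + total_weight es < 2 ^ ?p + 2 ^ ?q" using Cons.IH less_exp_val_size[of c] by simp
  also have "\<dots> \<le> 2 ^ (?p + ?q) + 2 ^ (?p + ?q)" by (intro add_mono power_increasing) auto
  also have "\<dots> = 2 ^ (?p + ?q + 1)" by simp
  also have "\<dots> \<le> 2 ^ val_size (enc_items (e # es))" by (intro power_increasing) (auto simp: e)
  finally show ?case by (simp add: total_weight_def e)
qed (simp add: total_weight_def)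

lemma wt_le_total_weight: "e \<in> set es \<Longrightarrow> wt e \<le> total_weight es"
  unfolding total_weight_def by (intro member_le_sum_list) auto

lemma ends_subset_lessThan:
  assumes "e \<in> set es" "val_size (enc_items es) \<le> S"
  shows "ends e \<subseteq> {..<2 ^ S}"
proof -
  obtain a b c where e: "e = (a, b, c)" by (cases e)
  have "val_size (enc_item e) \<le> S"
    using val_size_le_val_list[of "enc_item e" "map enc_item es"] assms by simp
  then show ?thesis by (auto simp: e intro!: less_exp_if_val_size_le)
qed

lemma state_bounded_instance:
  assumes vs: "val_size (val_list (map Num vs)) \<le> S" and es: "val_size (enc_items es) \<le> S"
    and W: "2 ^ S \<le> W"
  shows "state_bounded W S (vertex_items vs) es" "state_bounded W S es []"
proof -
  have "total_weight es < 2 ^ val_size (enc_items es)" by (rule total_weight_less)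
  also have "\<dots> \<le> 2 ^ S" using es by (intro power_increasing) auto
  finally have total: "total_weight es \<le> W" using W by simp
  have lengths: "length vs \<le> S" "length es \<le> S"
    using length_le_val_list[of "map Num vs"] length_le_val_list[of "map enc_item es"] vs es
    by simp_all
  have ends: "ends e \<subseteq> {..W}" if "e \<in> set es" for e
    using ends_subset_lessThan[OF that es] W by fastforce
  have verts: "v \<le> W" if "v \<in> set vs" for v
  proof -
    have "val_size (Num v) \<le> S"
      using val_size_le_val_list[of "Num v" "map Num vs"] that vs by simp
    then show ?thesis using less_exp_if_val_size_le[of v S] W by simp
  qed
  show "state_bounded W S (vertex_items vs) es"
    using lengths ends verts total by (auto simp: state_bounded_def)
  have "wt e \<le> W" if "e \<in> set es" for e using wt_le_total_weight[OF that] total by simp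
  then show "state_bounded W S es []"
    using lengths ends by (simp add: state_bounded_def total_weight_def)
qed

lemma call_within_mepvcb:
  assumes I: "mepvcb_instance I" "k3 I \<le> k1 I" and enc: "mepvcb_encodes I x"
  shows "call_within prog 0 x (enc_bool (mepvcb_yes I))
    (2 ^ (2 ^ (3 * k1 I + 5)) * (val_size x + 1) ^ 3)"
proof -
  obtain vs es where lists: "lists_instance I vs es" and x: "x = enc_instance I vs es"
    using enc mepvcb_encodes_iff by blast
  define N :: nat where "N = 2 ^ (2 * k1 I + 2)"
  define W where "W = 2 ^ val_size x + N"
  have size: "val_size y \<le> val_size x"
    if "y \<in> {val_list (map Num vs), enc_items es, Num (k1 I), Num (k2 I), Num (k3 I)}" for y
    unfolding x using that by (intro val_size_le_val_list) auto
  have "2 ^ val_size x \<le> W" "N \<le> W" by (simp_all add: W_def)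
  have "val_size (val_list (map Num vs)) \<le> val_size x" "val_size (enc_items es) \<le> val_size x"
    by (simp_all add: size)
  note bounded = state_bounded_instance[OF this \<open>2 ^ val_size x \<le> W\<close>]
  have "n \<le> W" if "n \<in> {k1 I, k2 I, k3 I}" for n
    using less_exp_if_val_size_le[OF size[of "Num n"]] that by (auto simp: W_def)
  then have "k1 I \<le> W" "k2 I \<le> W" "k3 I \<le> W" by simp_all
  note call_within_main[OF bounded this \<open>N \<le> W\<close> N_def, folded x]
  moreover have "mepvcb_yes I \<longleftrightarrow>
      search N (k1 I) N (vertex_items vs) es (k2 I) \<and> search N (k1 I) N es [] (k3 I)"
    unfolding N_def by (rule mepvcb_yes_iff_searches[OF I lists search_width_ge])
  ultimately show ?thesis
    using main_time_le[OF W_def N_def] by (simp add: call_within_mono)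
qed

theorem theorem4:
  "fpt_solvable {I. mepvcb_instance I \<and> k3 I \<le> k1 I} mepvcb_encodes mepvcb_yes k1"
  unfolding fpt_solvable_def
proof (rule exI[of _ prog], rule exI[of _ "\<lambda>n. 2 ^ (2 ^ (3 * n + 5))"],
    rule exI[of _ "[:1, 1:] ^ 3"], intro conjI ballI allI impI)
  show "computable (\<lambda>n. 2 ^ (2 ^ (3 * n + 5)))" by (rule computable_double_exp)
next
  fix I x assume "I \<in> {I. mepvcb_instance I \<and> k3 I \<le> k1 I}" "mepvcb_encodes I x"
  then have "call_within prog 0 x (enc_bool (mepvcb_yes I))
      (2 ^ (2 ^ (3 * k1 I + 5)) * (val_size x + 1) ^ 3)"
    by (intro call_within_mepvcb) auto
  then obtain t where "eval prog [x] (prog ! 0) (enc_bool (mepvcb_yes I)) t"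
    and "t \<le> 2 ^ (2 ^ (3 * k1 I + 5)) * poly ([:1, 1:] ^ 3) (val_size x)"
    by (auto simp: call_within_def call_def add.commute)
  then show "\<exists>t. run prog x (enc_bool (mepvcb_yes I)) t \<and>
      t \<le> 2 ^ (2 ^ (3 * k1 I + 5)) * poly ([:1, 1:] ^ 3) (val_size x)"
    unfolding run_def using length_prog by auto
qed

end
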